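(* The exterior tensor product is not separately continuous for the Hörmander topology. Precisely: let $\Gamma_1=\dot T^*\mathbb{R}$, $\Gamma_2=\emptyset\subset \dot T^*\mathbb{R}$ and $\Gamma=\{(x_1,x_2;\xi_1,0) : (x_1,x_2)\in\mathbb{R}^2,\ \xi_1\neq 0\}\subset\dot T^*\mathbb{R}^2$. Then the linear map $\mathcal{D}'_{\Gamma_1}(\mathbb{R})=\mathcal{D}'(\mathbb{R})\to\mathcal{D}'_\Gamma(\mathbb{R}^2)$, $u\mapsto u\boxtimes 1$ (exterior tensor product with the constant function $1\in\mathcal{D}'_{\Gamma_2}(\mathbb{R})$) is not continuous when the spaces carry the Hörmander topology.
   Context: For an open set $\Omega\subset\mathbb{R}^n$ write $\mathcal{D}(\Omega)=C_c^\infty(\Omega)$, $T^*\Omega=\Omega\times\mathbb{R}^n$ and $\dot T^*\Omega=\{(x;\xi)\in T^*\Omega : \xi\neq 0\}$. A cone in $\dot T^*\Omega$ is a subset $\Gamma$ such that $(x;\xi)\in\Gamma$ and $\lambda>0$ imply $(x;\lambda\xi)\in\Gamma$. For a closed cone $\Gamma$, $\mathcal{D}'_\Gamma(\Omega)=\{u\in\mathcal{D}'(\Omega) : \mathrm{WF}(u)\subset\Gamma\}$, where $\mathrm{WF}$ is the ($C^\infty$) wave front set. The Hörmander topology on $\mathcal{D}'_\Gamma(\Omega)$ is the locally convex topology defined by the seminorms (i) $\|u\|_\phi=|\langle u,\phi\rangle|$, $\phi\in\mathcal{D}(\Omega)$, and (ii) $\|u\|_{N,V,\chi}=\sup_{k\in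 V}(1+|k|)^N|\widehat{u\chi}(k)|$, where $N\ge 0$, $\chi\in\mathcal{D}(\Omega)$ and $V\subset\mathbb{R}^n$ is a closed cone with $(\operatorname{supp}\chi\times V)\cap\Gamma=\emptyset$. Here $\widehat{w}(k)=\langle w,e^{-ik\cdot x}\rangle$. *)

theory Defs
  imports "HOL-Analysis.Analysis"
begin

section \<open>Test functions\<close>

text \<open>Iterated partial derivatives are indexed by lists of basis vectors rather than by
  multi-indices.\<close>

primrec partial_derivs :: "'a::euclidean_space list \<Rightarrow> ('a \<Rightarrow> complex) \<Rightarrow> 'a \<Rightarrow> complex" where
  "partial_derivs [] f = f"
| "partial_derivs (b # bs) f = (\<lambda>x. frechet_derivative (partial_derivs bs f) (at x) b)"

text \<open>A function is smooth when all its iterated partial derivatives are totally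
  differentiable (hence also continuous) at every point.\<close>

definition smooth :: "('a::euclidean_space \<Rightarrow> complex) \<Rightarrow> bool" where
  "smooth f \<longleftrightarrow> (\<forall>bs. set bs \<subseteq> Basis \<longrightarrow> partial_derivs bs f differentiable_on UNIV)"

definition fun_supp :: "('a::topological_space \<Rightarrow> complex) \<Rightarrow> 'a set" where
  "fun_supp f = closure {x. f x \<noteq> 0}"

text \<open>Elements of \<open>\<D>(\<Omega>)\<close> are extended by zero to the whole space.\<close>

definition test_functions :: "'a::euclidean_space set \<Rightarrow> ('a \<Rightarrow> complex) set" where
  "test_functions \<Omega> = {\<phi>. smooth \<phi> \<and> compact (fun_supp \<phi>) \<and> fun_supp \<phi> \<subseteq> \<Omega>}"


section \<open>Distributions\<close>

text \<open>A distribution is a functional on \<open>\<D>(\<Omega>)\<close>; its value is fixed to be \<open>0\<close> off \<open>\<D>(\<Omega>)\<close>,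
  so that equality of distributions is equality of HOL functions.  Continuity is expressed
  by the usual seminorm estimates on each compact set.\<close>

definition distributions :: "'a::euclidean_space set \<Rightarrow> (('a \<Rightarrow> complex) \<Rightarrow> complex) set" where
  "distributions \<Omega> = {u.
     (\<forall>\<phi>. \<phi> \<notin> test_functions \<Omega> \<longrightarrow> u \<phi> = 0) \<and>
     (\<forall>\<phi>\<in>test_functions \<Omega>. \<forall>\<psi>\<in>test_functions \<Omega>. \<forall>a b.
        u (\<lambda>x. a * \<phi> x + b * \<psi> x) = a * u \<phi> + b * u \<psi>) \<and>
     (\<forall>K. compact K \<and> K \<subseteq> \<Omega> \<longrightarrow>
        (\<exists>C m. \<forall>\<phi>\<in>test_functions \<Omega>. fun_supp \<phi> \<subseteq> K \<longrightarrow>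
           cmod (u \<phi>) \<le> C * (\<Sum>bs | set bs \<subseteq> Basis \<and> length bs \<le> m.
                                   SUP x. cmod (partial_derivs bs \<phi> x))))}"

definition dist_of_fun :: "'a::euclidean_space set \<Rightarrow> ('a \<Rightarrow> complex) \<Rightarrow> ('a \<Rightarrow> complex) \<Rightarrow> complex" where
  "dist_of_fun \<Omega> f =
     (\<lambda>\<phi>. if \<phi> \<in> test_functions \<Omega> then (LINT x|lborel. f x * \<phi> x) else 0)"

text \<open>For \<open>\<rho> \<in> \<D>(\<Omega>)\<close> the distribution \<open>u\<rho>\<close> has compact support; the functional below is defined
  on every smooth \<open>\<phi>\<close>, since then \<open>\<rho>\<phi> \<in> \<D>(\<Omega>)\<close>.  In particular it may be tested on exponentials.\<close>

definition dist_times :: "(('a \<Rightarrow> complex) \<Rightarrow> complex) \<Rightarrow> ('a \<Rightarrow> complex) \<Rightarrow> ('a \<Rightarrow> complex) \<Rightarrow> complex" where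
  "dist_times u \<rho> = (\<lambda>\<phi>. u (\<lambda>x. \<rho> x * \<phi> x))"

definition fourier :: "(('a::euclidean_space \<Rightarrow> complex) \<Rightarrow> complex) \<Rightarrow> 'a \<Rightarrow> complex" where
  "fourier w k = w (\<lambda>x. exp (- \<i> * complex_of_real (k \<bullet> x)))"

text \<open>\<open>\<langle>u \<boxtimes> v, \<phi>\<rangle> = \<langle>u(x), \<langle>v(y), \<phi>(x,y)\<rangle>\<rangle>\<close>\<close>

definition ext_tensor ::
  "'a::euclidean_space set \<Rightarrow> 'b::euclidean_space set \<Rightarrow> (('a \<Rightarrow> complex) \<Rightarrow> complex) \<Rightarrow>
   (('b \<Rightarrow> complex) \<Rightarrow> complex) \<Rightarrow> ('a \<times> 'b \<Rightarrow> complex) \<Rightarrow> complex" where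
  "ext_tensor \<Omega>\<^sub>1 \<Omega>\<^sub>2 u v =
     (\<lambda>\<phi>. if \<phi> \<in> test_functions (\<Omega>\<^sub>1 \<times> \<Omega>\<^sub>2) then u (\<lambda>x. v (\<lambda>y. \<phi> (x, y))) else 0)"


section \<open>Wave front set and Hoermander topology\<close>

definition punctured_cotangent :: "'a::euclidean_space set \<Rightarrow> ('a \<times> 'a) set" where
  "punctured_cotangent \<Omega> = {(x, \<xi>). x \<in> \<Omega> \<and> \<xi> \<noteq> 0}"

text \<open>The library's \<^const>\<open>cone\<close> asks for stability under all \<open>\<lambda> \<ge> 0\<close>.  For closed sets of covectors
  this is the same as stability under \<open>\<lambda> > 0\<close>, and adding the origin to a conic neighbourhood
  does not affect the decay condition below.\<close>

definition wave_front_set ::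
  "'a::euclidean_space set \<Rightarrow> (('a \<Rightarrow> complex) \<Rightarrow> complex) \<Rightarrow> ('a \<times> 'a) set" where
  "wave_front_set \<Omega> u = {(x, \<xi>) \<in> punctured_cotangent \<Omega>.
     \<not> (\<exists>\<rho>\<in>test_functions \<Omega>. \<rho> x \<noteq> 0 \<and>
          (\<exists>V. cone V \<and> \<xi> \<in> interior V \<and>
             (\<forall>N. \<exists>C. \<forall>k\<in>V. (1 + norm k) ^ N * cmod (fourier (dist_times u \<rho>) k) \<le> C)))}"

definition distributions_wf ::
  "'a::euclidean_space set \<Rightarrow> ('a \<times> 'a) set \<Rightarrow> (('a \<Rightarrow> complex) \<Rightarrow> complex) set" where
  "distributions_wf \<Omega> \<Gamma> = {u \<in> distributions \<Omega>. wave_front_set \<Omega> u \<subseteq> \<Gamma>}"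

text \<open>The seminorms are taken in \<^typ>\<open>ennreal\<close> so that the supremum is meaningful without a
  preliminary boundedness proof.\<close>

definition weak_seminorm :: "('a \<Rightarrow> complex) \<Rightarrow> (('a \<Rightarrow> complex) \<Rightarrow> complex) \<Rightarrow> ennreal" where
  "weak_seminorm \<phi> u = ennreal (cmod (u \<phi>))"

definition decay_seminorm ::
  "nat \<Rightarrow> 'a::euclidean_space set \<Rightarrow> ('a \<Rightarrow> complex) \<Rightarrow> (('a \<Rightarrow> complex) \<Rightarrow> complex) \<Rightarrow> ennreal" where
  "decay_seminorm N V \<rho> u =
     (SUP k\<in>V. ennreal ((1 + norm k) ^ N * cmod (fourier (dist_times u \<rho>) k)))"

definition hormander_seminorms ::
  "'a::euclidean_space set \<Rightarrow> ('a \<times> 'a) set \<Rightarrow> ((('a \<Rightarrow> complex) \<Rightarrow> complex) \<Rightarrow> ennreal) set" where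
  "hormander_seminorms \<Omega> \<Gamma> =
     {weak_seminorm \<phi> | \<phi>. \<phi> \<in> test_functions \<Omega>} \<union>
     {decay_seminorm N V \<rho> | N V \<rho>. \<rho> \<in> test_functions \<Omega> \<and> closed V \<and> cone V \<and>
        (fun_supp \<rho> \<times> V) \<inter> \<Gamma> = {}}"

text \<open>The locally convex topology defined by a family of seminorms has the open seminorm balls
  (with arbitrary centres) as a subbase.\<close>

definition hormander_topology ::
  "'a::euclidean_space set \<Rightarrow> ('a \<times> 'a) set \<Rightarrow> (('a \<Rightarrow> complex) \<Rightarrow> complex) topology" where
  "hormander_topology \<Omega> \<Gamma> = topology_generated_by
     {{v \<in> distributions_wf \<Omega> \<Gamma>. p (\<lambda>\<phi>. v \<phi> - u \<phi>) < ennreal \<epsilon>} | p u \<epsilon>.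
        p \<in> hormander_seminorms \<Omega> \<Gamma> \<and> u \<in> distributions_wf \<Omega> \<Gamma> \<and> \<epsilon> > 0}"

lemma zero_test_function: "(\<lambda>x. 0) \<in> test_functions \<Omega>"
proof -
  have "partial_derivs bs (\<lambda>x. 0) = (\<lambda>x. 0)" for bs :: "'a list"
    by (induction bs) auto
  then show ?thesis
    by (simp add: test_functions_def smooth_def fun_supp_def)
qed

lemma topspace_hormander_topology:
  "topspace (hormander_topology \<Omega> \<Gamma>) = distributions_wf \<Omega> \<Gamma>"
proof
  show "topspace (hormander_topology \<Omega> \<Gamma>) \<subseteq> distributions_wf \<Omega> \<Gamma>"
    unfolding hormander_topology_def topology_generated_by_topspace by blast
next
  let ?p = "weak_seminorm (\<lambda>x. 0)"
  have p: "?p \<in> hormander_seminorms \<Omega> \<Gamma>"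
    unfolding hormander_seminorms_def using zero_test_function by blast
  show "distributions_wf \<Omega> \<Gamma> \<subseteq> topspace (hormander_topology \<Omega> \<Gamma>)"
  proof
    fix u assume u: "u \<in> distributions_wf \<Omega> \<Gamma>"
    let ?B = "{v \<in> distributions_wf \<Omega> \<Gamma>. ?p (\<lambda>\<phi>. v \<phi> - u \<phi>) < ennreal 1}"
    have "u \<in> ?B" using u by (simp add: weak_seminorm_def)
    then show "u \<in> topspace (hormander_topology \<Omega> \<Gamma>)"
      unfolding hormander_topology_def topology_generated_by_topspace
      using p u zero_less_one[where 'a=real] by blast
  qed
qed

lemma ext_tensor_product:
  assumes u: "u \<in> distributions \<Omega>\<^sub>1" and v: "v \<in> distributions \<Omega>\<^sub>2"
    and f: "f \<in> test_functions \<Omega>\<^sub>1" and g: "g \<in> test_functions \<Omega>\<^sub>2"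
    and fg: "(\<lambda>(x, y). f x * g y) \<in> test_functions (\<Omega>\<^sub>1 \<times> \<Omega>\<^sub>2)"
  shows "ext_tensor \<Omega>\<^sub>1 \<Omega>\<^sub>2 u v (\<lambda>(x, y). f x * g y) = u f * v g"
proof -
  have lin: "w (\<lambda>x. a * h x) = a * w h"
    if "w \<in> distributions \<Omega>" "h \<in> test_functions \<Omega>"
    for w and \<Omega> :: "'c::euclidean_space set" and h a
  proof -
    have "w (\<lambda>x. a * h x + 0 * h x) = a * w h + 0 * w h"
      using that unfolding distributions_def by blast
    then show ?thesis by simp
  qed
  have "u (\<lambda>x. v (\<lambda>y. f x * g y)) = u (\<lambda>x. v g * f x)"
    by (simp add: lin[OF v g] mult.commute)
  also have "\<dots> = u f * v g"
    by (subst lin[OF u f]) (rule mult.commute)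
  finally show ?thesis
    using fg by (simp add: ext_tensor_def)
qed

end

(* If the map were continuous, a preimage of a seminorm ball would be a neighbourhood of 0 in
   D'(R).  Since Gamma_1 is everything, the only seminorms on D'(R) are the weak
   ones, so this neighbourhood contains every u vanishing on some finite set F of test functions.
   The cone V = {|k_1| <= |k_2|} misses Gamma, and on rho_1 (x) rho_2 its seminorm of u (x) 1
   controls |u(rho_1 e^{-i k_1 x})| |rho_2^(k_2)| with k_2 = 1 fixed and |k_1| <= 1 arbitrary.
   A combination u of card F + 1 point masses can be made to vanish on F; a Vandermonde argument
   shows that it cannot also vanish on all the functions rho_1 e^{-i k_1 x} with
   k_1 = l / (card F + 1), so after rescaling it contradicts the seminorm bound. *)

theory Submission
  imports Defs
begin

section \<open>Smooth functions\<close>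

text \<open>As a function of u, the seminorm of u \<boxtimes> 1 is the supremum of |u| over the
  functions \<rho>_2^(k_2) \<rho>_1 e^{-i k_1 x} with |k_1| <= |k_2|. They form a bounded set of
  test functions with infinite-dimensional span: uniform convergence on bounded sets would control
  this supremum, finitely many values of u cannot. The topology of D'(R) is only weak because a cone
  that avoids every nonzero covector lies in {0}, where the decay seminorm is |u(\<chi>)|. Positions
  and frequencies are taken on one grid, so that e^{-i k_l x_j} is the l-th power of a node z_j;
  card F + 1 frequencies then separate card F + 1 nodes, and they all stay in [0, 1), which k_2 = 1
  allows. Non-continuity says something only if the map really lands in D'_\<Gamma>, and much of the
  work goes into this: x-derivatives must pass under the integral over y, and for covectors with
  \<xi>_2 nonzero the rapid decay of \<rho>_2^ in k_2 must beat the polynomial growth of u(\<rho>_1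
  e^{-i k_1 x}) in k_1. This works on cones |k_1| <= M |k_2|.\<close>

abbreviation pderiv_dir :: "'a::euclidean_space \<Rightarrow> ('a \<Rightarrow> complex) \<Rightarrow> 'a \<Rightarrow> complex" where
  "pderiv_dir b f \<equiv> (\<lambda>x. frechet_derivative f (at x) b)"

lemma partial_derivs_append:
  "partial_derivs (bs @ cs) f = partial_derivs bs (partial_derivs cs f)"
  by (induction bs) auto

text \<open>Stability under one derivative puts every iterated derivative into \<open>S\<close>, so
  smoothness can be shown without formulas for higher derivatives.\<close>

lemma smooth_coinduct:
  assumes "f \<in> S"
    and diff: "\<And>g. g \<in> S \<Longrightarrow> g differentiable_on UNIV"
    and deriv: "\<And>g b. g \<in> S \<Longrightarrow> b \<in> Basis \<Longrightarrow> pderiv_dir b g \<in> S"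
  shows "smooth f"
proof -
  have "set bs \<subseteq> Basis \<Longrightarrow> partial_derivs bs f \<in> S" for bs
    using assms by (induction bs) auto
  then show ?thesis
    by (auto simp: smooth_def diff)
qed

lemma smooth_partial_derivs:
  assumes "smooth f" "set bs \<subseteq> Basis"
  shows "smooth (partial_derivs bs f)"
  using assms by (auto simp: smooth_def simp flip: partial_derivs_append)

lemma smooth_pderiv_dir:
  assumes "smooth f" "b \<in> Basis"
  shows "smooth (pderiv_dir b f)"
  using smooth_partial_derivs[of f "[b]"] assms by simp

lemma smooth_has_derivative:
  assumes "smooth f"
  shows "(f has_derivative frechet_derivative f (at x)) (at x)"
proof -
  have "f differentiable_on UNIV"
    using assms[unfolded smooth_def, rule_format, of "[]"] by simp
  then show ?thesis
    by (simp add: differentiable_on_def frechet_derivative_works[symmetric])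
qed

lemma smooth_differentiable_on: "smooth f \<Longrightarrow> f differentiable_on UNIV"
  using smooth_has_derivative by (auto simp: differentiable_on_def differentiable_def)

lemma smooth_continuous_on: "smooth f \<Longrightarrow> continuous_on S f"
  by (rule continuous_on_subset[OF differentiable_imp_continuous_on[OF smooth_differentiable_on]])
    auto

lemma pderiv_dir_eqI:
  assumes "\<And>x. (f has_derivative D x) (at x)"
  shows "pderiv_dir b f = (\<lambda>x. D x b)"
  using frechet_derivative_at[OF assms] by metis

lemma differentiable_onI_has_derivative:
  assumes "\<And>x. (f has_derivative D x) (at x)"
  shows "f differentiable_on UNIV"
  using assms by (auto simp: differentiable_on_def differentiable_def)

lemma differentiable_on_UNIV_D:
  assumes "f differentiable_on UNIV"
  shows "(f has_derivative frechet_derivative f (at x)) (at x)"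
  using assms by (simp add: differentiable_on_def frechet_derivative_works[symmetric])

lemma smooth_const: "smooth (\<lambda>x. c)"
proof (rule smooth_coinduct[where S = "range (\<lambda>c x. c)"])
  fix g :: "'a \<Rightarrow> complex" and b :: 'a
  assume "g \<in> range (\<lambda>c x. c)"
  then obtain c where g: "g = (\<lambda>x. c)" by auto
  show "g differentiable_on UNIV" by (simp add: g)
  have "pderiv_dir b g = (\<lambda>x. 0)"
    by (rule pderiv_dir_eqI[where D = "\<lambda>x h. 0"]) (simp add: g)
  then show "pderiv_dir b g \<in> range (\<lambda>c x. c)" by auto
qed auto

text \<open>Smoothness is coinductive; the algebra generated by \<open>G\<close> and the smooth functions serves as
  an up-to closure, so that a derivative of a generator may be any polynomial in generators.\<close>

inductive_set smooth_closure :: "('a::euclidean_space \<Rightarrow> complex) set \<Rightarrow> ('a \<Rightarrow> complex) set"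
  for G where
  generator: "g \<in> G \<Longrightarrow> g \<in> smooth_closure G"
| smooth: "smooth g \<Longrightarrow> g \<in> smooth_closure G"
| add: "f \<in> smooth_closure G \<Longrightarrow> g \<in> smooth_closure G \<Longrightarrow> (\<lambda>x. f x + g x) \<in> smooth_closure G"
| mult: "f \<in> smooth_closure G \<Longrightarrow> g \<in> smooth_closure G \<Longrightarrow> (\<lambda>x. f x * g x) \<in> smooth_closure G"

lemma smooth_closure_sum:
  assumes "finite A" "\<And>a. a \<in> A \<Longrightarrow> f a \<in> smooth_closure G"
  shows "(\<lambda>x. \<Sum>a\<in>A. f a x) \<in> smooth_closure G"
  using assms by (induction A rule: finite_induct)
    (auto intro: smooth_closure.smooth smooth_closure.add smooth_const)

text \<open>The sum and product rules make the closure stable under partial derivatives, so it can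
  serve as the invariant set of \<open>smooth_coinduct\<close>. Taking \<open>G\<close> empty
  already gives that sums and products of smooth functions are smooth.\<close>

lemma smooth_upto:
  assumes diff: "\<And>g. g \<in> G \<Longrightarrow> g differentiable_on UNIV"
    and deriv: "\<And>g b. g \<in> G \<Longrightarrow> b \<in> Basis \<Longrightarrow> pderiv_dir b g \<in> smooth_closure G"
    and f: "f \<in> smooth_closure G"
  shows "smooth f"
proof (rule smooth_coinduct[OF f])
  fix g assume "g \<in> smooth_closure G"
  then have "g differentiable_on UNIV \<and> (\<forall>b\<in>Basis. pderiv_dir b g \<in> smooth_closure G)"
  proof induction
    case (add f g)
    have D: "((\<lambda>x. f x + g x) has_derivative
        (\<lambda>h. frechet_derivative f (at x) h + frechet_derivative g (at x) h)) (at x)" for x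
      using add.IH by (intro has_derivative_add differentiable_on_UNIV_D) auto
    show ?case
      using add differentiable_onI_has_derivative[OF D] pderiv_dir_eqI[OF D]
      by (auto intro!: smooth_closure.add)
  next
    case (mult f g)
    have D: "((\<lambda>x. f x * g x) has_derivative
        (\<lambda>h. f x * frechet_derivative g (at x) h + frechet_derivative f (at x) h * g x)) (at x)" for x
      using mult.IH by (intro has_derivative_mult differentiable_on_UNIV_D) auto
    show ?case
      using mult differentiable_onI_has_derivative[OF D] pderiv_dir_eqI[OF D]
      by (auto intro!: smooth_closure.add smooth_closure.mult)
  qed (auto simp: diff deriv smooth_differentiable_on intro: smooth_closure.smooth smooth_pderiv_dir)
  then show "g differentiable_on UNIV"
    "\<And>b. b \<in> Basis \<Longrightarrow> pderiv_dir b g \<in> smooth_closure G"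
    by auto
qed

lemma smooth_add: "smooth f \<Longrightarrow> smooth g \<Longrightarrow> smooth (\<lambda>x. f x + g x)"
  by (rule smooth_upto[where G = "{}"]) (auto intro: smooth_closure.intros)

lemma smooth_mult: "smooth f \<Longrightarrow> smooth g \<Longrightarrow> smooth (\<lambda>x. f x * g x)"
  by (rule smooth_upto[where G = "{}"]) (auto intro: smooth_closure.intros)

text \<open>By the chain rule a partial derivative of \<open>h (L x + a)\<close> is a combination,
  with constant coefficients, of partial derivatives of \<open>h\<close> at the same affine
  argument. All such compositions together therefore form a suitable set of generators. Affine maps
  cover the coordinate projections, the slices and the shifted reflections needed later.\<close>

lemma smooth_compose_affine:
  fixes L :: "'a::euclidean_space \<Rightarrow> 'b::euclidean_space"
  assumes L: "bounded_linear L" and f: "smooth f"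
  shows "smooth (\<lambda>x. f (L x + a))"
proof -
  define G where "G = {(\<lambda>x. h (L x + a)) | h. smooth h}"
  have D: "((\<lambda>x. h (L x + a)) has_derivative
      (\<lambda>v. \<Sum>c\<in>Basis. of_real (L v \<bullet> c) * pderiv_dir c h (L x + a))) (at x)"
    if "smooth h" for h x
  proof -
    let ?D = "frechet_derivative h (at (L x + a))"
    have "((\<lambda>x. L x + a) has_derivative L) (at x)"
      using has_derivative_add[OF bounded_linear_imp_has_derivative[OF L] has_derivative_const]
      by simp
    then have "((\<lambda>x. h (L x + a)) has_derivative (\<lambda>v. ?D (L v))) (at x)"
      by (rule has_derivative_compose[OF _ smooth_has_derivative[OF that]])
    moreover have "?D (L v) = (\<Sum>c\<in>Basis. of_real (L v \<bullet> c) * ?D c)" for v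
    proof -
      have lin: "linear ?D"
        using smooth_has_derivative[OF that] by (rule has_derivative_linear)
      have "?D (\<Sum>c\<in>Basis. (L v \<bullet> c) *\<^sub>R c) = (\<Sum>c\<in>Basis. (L v \<bullet> c) *\<^sub>R ?D c)"
        by (simp only: linear_sum[OF lin] linear_cmul[OF lin])
      then show ?thesis
        by (simp add: euclidean_representation scaleR_conv_of_real)
    qed
    ultimately show ?thesis by (simp only:)
  qed
  show ?thesis
  proof (rule smooth_upto[of G])
    fix g b assume "g \<in> G"
    then obtain h where h: "smooth h" and g: "g = (\<lambda>x. h (L x + a))"
      by (auto simp: G_def)
    show "g differentiable_on UNIV"
      using differentiable_onI_has_derivative[OF D[OF h]] by (simp add: g)
    have "(\<lambda>x. of_real (L b \<bullet> c) * pderiv_dir c h (L x + a)) \<in> smooth_closure G"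
      if "c \<in> Basis" for c
      using smooth_pderiv_dir[OF h that]
      by (intro smooth_closure.mult[OF smooth_closure.smooth[OF smooth_const]]
            smooth_closure.generator) (auto simp: G_def)
    then show "pderiv_dir b g \<in> smooth_closure G"
      unfolding g pderiv_dir_eqI[OF D[OF h]] by (intro smooth_closure_sum) auto
  qed (use f in \<open>auto simp: G_def intro: smooth_closure.generator\<close>)
qed

section \<open>Characters and the flat function exp(-1/t)\<close>

abbreviation character :: "'a::euclidean_space \<Rightarrow> 'a \<Rightarrow> complex" where
  "character k \<equiv> (\<lambda>x. exp (- \<i> * complex_of_real (k \<bullet> x)))"

lemma has_derivative_character:
  "(character k has_derivative (\<lambda>h. - \<i> * of_real (k \<bullet> h) * character k x)) (at x)"
proof -
  have "((\<lambda>x. - \<i> * complex_of_real (k \<bullet> x)) has_derivative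
      (\<lambda>h. - \<i> * of_real (k \<bullet> h))) (at x)"
    by (intro has_derivative_mult_right has_derivative_of_real has_derivative_inner_right
        has_derivative_ident)
  from has_derivative_compose[OF this DERIV_exp[unfolded has_field_derivative_def]]
  show ?thesis
    by (simp add: mult_ac)
qed

lemma smooth_character: "smooth (character k)"
proof (rule smooth_upto[of "{character k}"])
  fix g b assume "g \<in> {character k}"
  then have g: "g = character k" by simp
  show "g differentiable_on UNIV"
    unfolding g by (rule differentiable_onI_has_derivative[OF has_derivative_character])
  show "pderiv_dir b g \<in> smooth_closure {character k}"
    unfolding g pderiv_dir_eqI[OF has_derivative_character]
    by (intro smooth_closure.mult[OF smooth_closure.smooth[OF smooth_const]]
        smooth_closure.generator) auto
qed (auto intro: smooth_closure.generator)

text \<open>The functions exp(-1/t) / t^n, extended by 0 to the left, form a family whose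
  derivatives are combinations of its members. This makes it a generating set for
  \<open>smooth_upto\<close>; the only delicate point is t = 0.\<close>

lemma DERIV_exp_minus_inverse:
  fixes h :: "nat \<Rightarrow> real \<Rightarrow> real"
  defines "h \<equiv> \<lambda>n t. if t \<le> 0 then 0 else exp (- 1 / t) / t ^ n"
  shows "(h n has_real_derivative h (n + 2) t - n * h (n + 1) t) (at t)"
proof -
  consider "t < 0" | "t > 0" | "t = 0" by linarith
  then show ?thesis
  proof cases
    case 1
    have "((\<lambda>t. 0) has_real_derivative h (n + 2) t - n * h (n + 1) t) (at t)"
      using 1 by (simp add: h_def)
    then show ?thesis
      by (rule DERIV_cong_ev[THEN iffD1, rotated -1, OF _ refl _ refl])
        (use eventually_nhds_in_open[of "{..<0}" t] 1 in \<open>auto simp: h_def elim!: eventually_mono\<close>)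
  next
    case 2
    have "((\<lambda>t. exp (- 1 / t) / t ^ n) has_real_derivative h (n + 2) t - n * h (n + 1) t) (at t)"
    proof (cases n)
      case (Suc m)
      show ?thesis
        unfolding Suc by (rule derivative_eq_intros refl | use 2 in \<open>simp add: h_def field_simps power2_eq_square\<close>)+
    qed (use 2 in \<open>auto intro!: derivative_eq_intros simp: h_def power2_eq_square\<close>)
    then show ?thesis
      by (rule DERIV_cong_ev[THEN iffD1, rotated -1, OF _ refl _ refl])
        (use eventually_nhds_in_open[of "{0<..}" t] 2 in \<open>auto simp: h_def elim!: eventually_mono\<close>)
  next
    case 3
    \<comment> \<open>With s = 1/y the difference quotient \<open>h n y / y\<close> becomes s^(n+1)
      / e^s, and s tends to infinity.\<close>
    have "((\<lambda>y. inverse y ^ (n + 1) / exp (inverse y)) \<longlongrightarrow> 0) (at_right (0::real))"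
      by (rule filterlim_compose[OF tendsto_power_div_exp_0 filterlim_inverse_at_top_right])
    then have R: "((\<lambda>y. h n y / y) \<longlongrightarrow> 0) (at_right 0)"
      by (rule Lim_transform_eventually)
        (use eventually_at_right_less[of 0] in
          \<open>auto simp: h_def exp_minus divide_simps elim!: eventually_mono\<close>)
    have "((\<lambda>y. h n y / y) \<longlongrightarrow> 0) (at_left 0)"
      by (rule Lim_transform_eventually[OF tendsto_const])
        (auto simp: h_def eventually_at_filter)
    with R have "((\<lambda>y. h n y / y) \<longlongrightarrow> 0) (at 0)"
      by (simp add: filterlim_split_at)
    then show ?thesis
      using 3 by (simp add: h_def has_field_derivative_iff)
  qed
qed

lemma smooth_exp_minus_inverse:
  "smooth (\<lambda>t::real. if t \<le> 0 then 0 else of_real (exp (- 1 / t)))"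
proof -
  define h :: "nat \<Rightarrow> real \<Rightarrow> real"
    where "h = (\<lambda>n t. if t \<le> 0 then 0 else exp (- 1 / t) / t ^ n)"
  define G where "G = range (\<lambda>n t. complex_of_real (h n t))"
  have D: "((\<lambda>t. complex_of_real (h n t)) has_derivative
      (\<lambda>v. of_real ((h (n + 2) t - n * h (n + 1) t) * v))) (at t)" for n t
    using DERIV_exp_minus_inverse[of n t]
    unfolding has_field_derivative_def h_def by (rule has_derivative_of_real)
  have "smooth (\<lambda>t. complex_of_real (h 0 t))"
  proof (rule smooth_upto[of G])
    fix g and b :: real assume "g \<in> G"
    then obtain n where g: "g = (\<lambda>t. complex_of_real (h n t))" by (auto simp: G_def)
    show "g differentiable_on UNIV"
      unfolding g by (rule differentiable_onI_has_derivative[OF D])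
    have "(\<lambda>t. of_real (h (n + 2) t) * of_real b
        + complex_of_real (h (n + 1) t) * of_real (- n * b)) \<in> smooth_closure G"
      by (intro smooth_closure.add smooth_closure.mult smooth_closure.smooth[OF smooth_const]
          smooth_closure.generator) (auto simp: G_def)
    then show "pderiv_dir b g \<in> smooth_closure G"
      unfolding g pderiv_dir_eqI[OF D] by (simp add: algebra_simps)
  qed (auto simp: G_def intro: smooth_closure.generator)
  then show ?thesis by (simp add: h_def if_distrib[of complex_of_real] cong: if_cong)
qed

section \<open>Test functions and distributions\<close>

lemma fun_supp_subset:
  assumes "closed K" "\<And>x. x \<notin> K \<Longrightarrow> f x = 0"
  shows "fun_supp f \<subseteq> K"
  unfolding fun_supp_def using assms by (intro closure_minimal) auto

lemma fun_supp_eq_0: "x \<notin> fun_supp f \<Longrightarrow> f x = 0"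
  unfolding fun_supp_def using closure_subset[of "{x. f x \<noteq> 0}"] by auto

lemma test_functionsI:
  assumes "smooth f" "compact K" "\<And>x. x \<notin> K \<Longrightarrow> f x = 0"
  shows "f \<in> test_functions UNIV"
proof -
  have "fun_supp f \<subseteq> K"
    using assms compact_imp_closed by (intro fun_supp_subset) auto
  then have "compact (fun_supp f)"
    using compact_Int_closed[OF \<open>compact K\<close>, of "fun_supp f"]
    by (simp add: fun_supp_def inf.absorb2)
  then show ?thesis
    using assms(1) by (simp add: test_functions_def)
qed

lemma test_function_smooth: "f \<in> test_functions \<Omega> \<Longrightarrow> smooth f"
  by (simp add: test_functions_def)

lemma test_function_compact: "f \<in> test_functions \<Omega> \<Longrightarrow> compact (fun_supp f)"
  by (simp add: test_functions_def)

text \<open>The complement of the support is open, so the previous derivative vanishes near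
  \<open>x\<close> and not only at \<open>x\<close>; hence the induction generalizes over the
  point.\<close>

lemma partial_derivs_outside_fun_supp:
  assumes "x \<notin> fun_supp f"
  shows "partial_derivs bs f x = 0"
  using assms
proof (induction bs arbitrary: x)
  case Nil
  then show ?case by (simp add: fun_supp_eq_0)
next
  case (Cons b bs)
  have "((\<lambda>x. 0) has_derivative (\<lambda>h. 0)) (at x)"
    by simp
  then have "(partial_derivs bs f has_derivative (\<lambda>h. 0)) (at x)"
    by (rule has_derivative_transform_within_open[where s = "- fun_supp f"])
      (use Cons in \<open>auto simp: fun_supp_def\<close>)
  then show ?case
    by (simp flip: frechet_derivative_at)
qed

lemma test_functions_partial_derivs:
  assumes "f \<in> test_functions UNIV" "set bs \<subseteq> Basis"
  shows "partial_derivs bs f \<in> test_functions UNIV"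
  using assms partial_derivs_outside_fun_supp test_function_compact
  by (intro test_functionsI[of _ "fun_supp f"] smooth_partial_derivs) (auto dest: test_function_smooth)

lemma test_functions_pderiv_dir:
  assumes "f \<in> test_functions UNIV" "b \<in> Basis"
  shows "pderiv_dir b f \<in> test_functions UNIV"
  using test_functions_partial_derivs[of f "[b]"] assms by simp

lemma test_functions_add:
  assumes "f \<in> test_functions UNIV" "g \<in> test_functions UNIV"
  shows "(\<lambda>x. f x + g x) \<in> test_functions UNIV"
  using assms
  by (intro test_functionsI[of _ "fun_supp f \<union> fun_supp g"] smooth_add compact_Un)
    (auto simp: test_functions_def fun_supp_eq_0)

lemma test_functions_mult:
  assumes "f \<in> test_functions UNIV" "smooth g"
  shows "(\<lambda>x. f x * g x) \<in> test_functions UNIV"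
  using assms
  by (intro test_functionsI[of _ "fun_supp f"] smooth_mult) (auto simp: test_functions_def fun_supp_eq_0)

lemma test_functions_cmult:
  assumes "f \<in> test_functions UNIV"
  shows "(\<lambda>x. c * f x) \<in> test_functions UNIV"
  using test_functions_mult[OF assms smooth_const[of c]] by (simp add: mult.commute)

lemma test_functions_tensor:
  fixes f :: "'a::euclidean_space \<Rightarrow> complex" and g :: "'b::euclidean_space \<Rightarrow> complex"
  assumes f: "f \<in> test_functions UNIV" and g: "g \<in> test_functions UNIV"
  shows "(\<lambda>z. f (fst z) * g (snd z)) \<in> test_functions UNIV"
proof (rule test_functionsI)
  show "smooth (\<lambda>z::'a \<times> 'b. f (fst z) * g (snd z))"
    using smooth_compose_affine[OF bounded_linear_fst test_function_smooth[OF f], of 0]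
      smooth_compose_affine[OF bounded_linear_snd test_function_smooth[OF g], of 0]
    by (intro smooth_mult) auto
  show "compact (fun_supp f \<times> fun_supp g)"
    using f g by (intro compact_Times test_function_compact)
qed (auto simp: mem_Times_iff fun_supp_eq_0)

lemma test_functions_slice:
  fixes \<phi> :: "'a::euclidean_space \<times> 'b::euclidean_space \<Rightarrow> complex"
  assumes \<phi>: "\<phi> \<in> test_functions UNIV"
  shows "(\<lambda>y. \<phi> (x, y)) \<in> test_functions UNIV"
proof (rule test_functionsI)
  have "bounded_linear (\<lambda>y::'b. (0::'a, y))"
    by (intro bounded_linear_Pair bounded_linear_zero bounded_linear_ident)
  from smooth_compose_affine[OF this test_function_smooth[OF \<phi>], of "(x, 0)"]
  show "smooth (\<lambda>y. \<phi> (x, y))" by simp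
  show "compact (snd ` fun_supp \<phi>)"
    by (intro compact_continuous_image continuous_on_snd continuous_on_id
        test_function_compact[OF \<phi>])
  show "\<phi> (x, y) = 0" if "y \<notin> snd ` fun_supp \<phi>" for y
    using that by (intro fun_supp_eq_0) force
qed

lemma test_function_bdd_above:
  fixes f :: "'a::euclidean_space \<Rightarrow> complex"
  assumes f: "f \<in> test_functions UNIV"
  shows "bdd_above (range (\<lambda>x. cmod (f x)))"
proof -
  have "compact (f ` fun_supp f)"
    using f by (intro compact_continuous_image smooth_continuous_on)
      (auto simp: test_functions_def)
  then obtain B where B: "\<And>x. x \<in> fun_supp f \<Longrightarrow> cmod (f x) \<le> B"
    using compact_imp_bounded by (force simp: bounded_iff)
  have "cmod (f x) \<le> max B 0" for x
    using B fun_supp_eq_0[of x f] by (cases "x \<in> fun_supp f") (auto simp: le_max_iff_disj)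
  then show ?thesis by (auto simp: bdd_above_def)
qed

lemma test_function_integrable:
  fixes f :: "'a::euclidean_space \<Rightarrow> complex"
  assumes f: "f \<in> test_functions UNIV"
  shows "integrable lborel f"
proof -
  have "integrable lborel (\<lambda>x. indicator (fun_supp f) x *\<^sub>R f x)"
    using f by (intro borel_integrable_compact smooth_continuous_on)
      (auto simp: test_functions_def)
  also have "(\<lambda>x. indicator (fun_supp f) x *\<^sub>R f x) = f"
    by (auto simp: indicator_def fun_supp_eq_0)
  finally show ?thesis .
qed

text \<open>A bridge from the Lebesgue integral in \<open>dist_of_fun\<close> to the gauge integral,
  in terms of which the fundamental theorem of calculus and the Leibniz rule are applied
  below.\<close>

lemma lborel_integral_eq_integral_compact:
  fixes f :: "'a::euclidean_space \<Rightarrow> complex"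
  assumes "continuous_on K f" "compact K" "\<And>x. x \<notin> K \<Longrightarrow> f x = 0"
  shows "(LINT x|lborel. f x) = integral K f"
proof -
  have eq: "indicator K x *\<^sub>R f x = f x" for x
    using assms(3) by (auto simp: indicator_def)
  have "(LINT x:K|lborel. f x) = integral K f"
    using assms borel_integrable_compact[of K f]
    by (intro set_borel_integral_eq_integral(2)) (auto simp: set_integrable_def)
  then show ?thesis
    by (simp add: set_lebesgue_integral_def eq)
qed

text \<open>The product of two one-sided flat functions, one vanishing left of a - 1 and the other
  right of a + 1. Knowing exactly where \<open>r\<close> is positive serves twice: for cutoffs
  without zeros on an interval, and for a bump with nonzero integral.\<close>

lemma exists_bump:
  fixes a :: real
  obtains r where "\<And>x. r x \<ge> 0" "\<And>x. r x > 0 \<longleftrightarrow> \<bar>x - a\<bar> < 1"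
    "(\<lambda>x. complex_of_real (r x)) \<in> test_functions UNIV"
proof
  let ?e = "\<lambda>t::real. if t \<le> 0 then 0 else exp (- 1 / t)"
  let ?r = "\<lambda>x. ?e (x + (1 - a)) * ?e (- x + (a + 1))"
  show "?r x \<ge> 0" "?r x > 0 \<longleftrightarrow> \<bar>x - a\<bar> < 1" for x
    by (auto simp: zero_less_mult_iff)
  have e: "smooth (\<lambda>t. complex_of_real (?e t))"
    using smooth_exp_minus_inverse by (simp add: if_distrib[of complex_of_real] cong: if_cong)
  have "smooth (\<lambda>x. complex_of_real (?e (x + (1 - a))) * complex_of_real (?e (- x + (a + 1))))"
    by (intro smooth_mult smooth_compose_affine[OF bounded_linear_ident e]
        smooth_compose_affine[OF bounded_linear_minus[OF bounded_linear_ident] e])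
  then show "(\<lambda>x. complex_of_real (?r x)) \<in> test_functions UNIV"
    by (intro test_functionsI[of _ "{a - 1..a + 1}"]) auto
qed

section \<open>The C^m norms and the continuity estimate for distributions\<close>

definition Ck_norm :: "nat \<Rightarrow> ('a::euclidean_space \<Rightarrow> complex) \<Rightarrow> real" where
  "Ck_norm m \<phi> = (\<Sum>bs | set bs \<subseteq> Basis \<and> length bs \<le> m. SUP x. cmod (partial_derivs bs \<phi> x))"

lemma distributionsI:
  assumes "\<And>\<phi>. \<phi> \<notin> test_functions UNIV \<Longrightarrow> u \<phi> = 0"
    and "\<And>\<phi> \<psi> a b. \<phi> \<in> test_functions UNIV \<Longrightarrow> \<psi> \<in> test_functions UNIV \<Longrightarrow>
      u (\<lambda>x. a * \<phi> x + b * \<psi> x) = a * u \<phi> + b * u \<psi>"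
    and "\<And>K. compact K \<Longrightarrow>
      \<exists>C m. \<forall>\<phi>\<in>test_functions UNIV. fun_supp \<phi> \<subseteq> K \<longrightarrow> cmod (u \<phi>) \<le> C * Ck_norm m \<phi>"
  shows "u \<in> distributions UNIV"
  using assms unfolding distributions_def Ck_norm_def by simp

lemma finite_lists_Basis: "finite {bs. set bs \<subseteq> (Basis::'a::euclidean_space set) \<and> length bs \<le> m}"
  by (rule finite_lists_length_le) simp

text \<open>A real-valued supremum bounds its terms only if the range is bounded above; compact
  support supplies that bound.\<close>

lemma cmod_partial_derivs_le_SUP:
  assumes "\<phi> \<in> test_functions UNIV" "set bs \<subseteq> Basis"
  shows "cmod (partial_derivs bs \<phi> x) \<le> (SUP x. cmod (partial_derivs bs \<phi> x))"
  using test_function_bdd_above[OF test_functions_partial_derivs[OF assms]]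
  by (intro cSUP_upper) auto

lemma SUP_cmod_partial_derivs_nonneg:
  assumes "\<phi> \<in> test_functions UNIV" "set bs \<subseteq> Basis"
  shows "0 \<le> (SUP x. cmod (partial_derivs bs \<phi> x))"
  using cmod_partial_derivs_le_SUP[OF assms] norm_ge_zero order_trans by blast

lemma cmod_le_Ck_norm:
  assumes "\<phi> \<in> test_functions UNIV"
  shows "cmod (\<phi> x) \<le> Ck_norm m \<phi>"
proof -
  have "cmod (\<phi> x) \<le> (SUP x. cmod (partial_derivs [] \<phi> x))"
    using cmod_partial_derivs_le_SUP[OF assms, of "[]"] by simp
  also have "\<dots> \<le> Ck_norm m \<phi>"
    unfolding Ck_norm_def
    by (intro member_le_sum[where f = "\<lambda>bs. SUP x. cmod (partial_derivs bs \<phi> x)"])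
       (auto intro: finite_lists_Basis SUP_cmod_partial_derivs_nonneg[OF assms])
  finally show ?thesis .
qed

text \<open>The constant is made nonnegative by passing to its absolute value, which is harmless
  because the norm is nonnegative. Later estimates multiply bounds on the norm by this constant and
  need its sign.\<close>

lemma distributions_estimate:
  fixes u :: "('a::euclidean_space \<Rightarrow> complex) \<Rightarrow> complex"
  assumes "u \<in> distributions UNIV" "compact K"
  obtains C m where "C \<ge> 0"
    "\<And>\<phi>. \<phi> \<in> test_functions UNIV \<Longrightarrow> fun_supp \<phi> \<subseteq> K \<Longrightarrow> cmod (u \<phi>) \<le> C * Ck_norm m \<phi>"
proof -
  have "\<exists>C m. \<forall>\<phi>\<in>test_functions UNIV. fun_supp \<phi> \<subseteq> K \<longrightarrow> cmod (u \<phi>) \<le> C * Ck_norm m \<phi>"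
    using assms by (simp add: distributions_def Ck_norm_def)
  then obtain C m where C: "cmod (u \<phi>) \<le> C * Ck_norm m \<phi>"
    if "\<phi> \<in> test_functions UNIV" "fun_supp \<phi> \<subseteq> K" for \<phi>
    by auto
  show ?thesis
  proof
    show "\<bar>C\<bar> \<ge> 0" by simp
    fix \<phi> :: "'a \<Rightarrow> complex"
    assume \<phi>: "\<phi> \<in> test_functions UNIV" "fun_supp \<phi> \<subseteq> K"
    have "0 \<le> Ck_norm m \<phi>"
      using cmod_le_Ck_norm[OF \<phi>(1)] norm_ge_zero order_trans by blast
    then have "C * Ck_norm m \<phi> \<le> \<bar>C\<bar> * Ck_norm m \<phi>"
      by (intro mult_right_mono) auto
    with C[OF \<phi>] show "cmod (u \<phi>) \<le> \<bar>C\<bar> * Ck_norm m \<phi>" by simp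
  qed
qed

lemma cmod_character [simp]: "cmod (character k x) = 1"
proof -
  have "character k x = cis (- (k \<bullet> x))"
    by (simp add: cis_conv_exp)
  then show ?thesis by (simp only: norm_cis)
qed

lemma cmod_lborel_integral_le:
  fixes f :: "'a::euclidean_space \<Rightarrow> complex"
  assumes f: "f \<in> test_functions UNIV" and K: "compact K" "fun_supp f \<subseteq> K"
    and B: "\<And>x. cmod (f x) \<le> B"
  shows "cmod (LINT x|lborel. f x) \<le> B * measure lborel K"
proof -
  have K': "K \<in> sets lborel" "emeasure lborel K < \<infinity>"
    using K(1) emeasure_compact_finite by (auto simp: borel_compact)
  have "cmod (LINT x|lborel. f x) \<le> (LINT x|lborel. cmod (f x))"
    by (rule integral_norm_bound)
  also have "\<dots> \<le> (LINT x|lborel. B * indicator K x)"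
  proof (rule integral_mono)
    show "integrable lborel (\<lambda>x. cmod (f x))"
      by (intro integrable_norm test_function_integrable f)
    show "integrable lborel (\<lambda>x. B * indicator K x)"
      using K' by (intro integrable_mult_right integrable_real_indicator)
    show "cmod (f x) \<le> B * indicator K x" for x
      using B[of x] K(2) fun_supp_eq_0[of x f] by (auto simp: indicator_def)
  qed
  also have "\<dots> = B * measure lborel K"
    using K' by simp
  finally show ?thesis .
qed

lemma dist_of_fun_one_distribution:
  "dist_of_fun UNIV (\<lambda>x. 1) \<in> distributions (UNIV :: 'a::euclidean_space set)"
proof -
  let ?u = "dist_of_fun (UNIV :: 'a set) (\<lambda>x. 1)"
  have lin: "?u (\<lambda>x. a * \<phi> x + b * \<psi> x) = a * ?u \<phi> + b * ?u \<psi>"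
    if "\<phi> \<in> test_functions UNIV" "\<psi> \<in> test_functions UNIV" for \<phi> \<psi> a b
  proof -
    have "(LINT x|lborel. a * \<phi> x + b * \<psi> x) = (LINT x|lborel. a * \<phi> x) + (LINT x|lborel. b * \<psi> x)"
      by (intro Bochner_Integration.integral_add test_function_integrable test_functions_cmult that)
    then show ?thesis
      using that by (simp add: dist_of_fun_def test_functions_add test_functions_cmult)
  qed
  have "\<exists>C m. \<forall>\<phi>\<in>test_functions UNIV. fun_supp \<phi> \<subseteq> K \<longrightarrow> cmod (?u \<phi>) \<le> C * Ck_norm m \<phi>"
    if "compact K" for K
  proof (intro exI ballI impI)
    fix \<phi> :: "'a \<Rightarrow> complex"
    assume \<phi>: "\<phi> \<in> test_functions UNIV" "fun_supp \<phi> \<subseteq> K"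
    then show "cmod (?u \<phi>) \<le> measure lborel K * Ck_norm 0 \<phi>"
      using cmod_lborel_integral_le[OF \<phi>(1) that \<phi>(2) cmod_le_Ck_norm[OF \<phi>(1)]]
      by (simp add: dist_of_fun_def mult.commute)
  qed
  with lin show ?thesis
    by (intro distributionsI) (simp add: dist_of_fun_def)
qed

section \<open>Fourier transforms of test functions on the line\<close>

lemma test_function_real_support:
  fixes f :: "real \<Rightarrow> complex"
  assumes "f \<in> test_functions UNIV"
  obtains R where "R > 0" "\<And>x. \<bar>x\<bar> \<ge> R \<Longrightarrow> f x = 0"
proof -
  obtain B where B: "\<And>x. x \<in> fun_supp f \<Longrightarrow> \<bar>x\<bar> \<le> B"
    using compact_imp_bounded[OF test_function_compact[OF assms]] by (auto simp: bounded_iff)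
  show ?thesis
  proof
    show "\<bar>B\<bar> + 1 > 0" by simp
    show "f x = 0" if "\<bar>x\<bar> \<ge> \<bar>B\<bar> + 1" for x
      using B[of x] that by (intro fun_supp_eq_0) auto
  qed
qed

lemma smooth_has_vector_derivative:
  fixes f :: "real \<Rightarrow> complex"
  assumes "smooth f"
  shows "(f has_vector_derivative pderiv_dir 1 f x) (at x within S)"
proof -
  have D: "(f has_derivative frechet_derivative f (at x)) (at x)"
    by (rule smooth_has_derivative[OF assms])
  have "frechet_derivative f (at x) h = h *\<^sub>R frechet_derivative f (at x) 1" for h
    using linear_cmul[OF has_derivative_linear[OF D], of h 1] by simp
  then have "frechet_derivative f (at x) = (\<lambda>h. h *\<^sub>R pderiv_dir 1 f x)" ..
  with D have "(f has_vector_derivative pderiv_dir 1 f x) (at x)"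
    by (simp add: has_vector_derivative_def)
  then show ?thesis
    by (rule has_vector_derivative_at_within)
qed

lemma integral_derivative_test_function:
  fixes f :: "real \<Rightarrow> complex"
  assumes f: "f \<in> test_functions UNIV"
  shows "(LINT x|lborel. pderiv_dir 1 f x) = 0"
proof -
  obtain R where R: "R > 0" "\<And>x. \<bar>x\<bar> \<ge> R \<Longrightarrow> f x = 0"
    using test_function_real_support[OF f] by blast
  have supp: "fun_supp f \<subseteq> {- R..R}"
    using R by (intro fun_supp_subset) (auto simp: abs_le_iff)
  have "(LINT x|lborel. pderiv_dir 1 f x) = integral {- R..R} (pderiv_dir 1 f)"
    using f supp partial_derivs_outside_fun_supp[of _ f "[1]"]
    by (intro lborel_integral_eq_integral_compact smooth_continuous_on smooth_pderiv_dir)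
      (auto simp: test_functions_def subset_iff)
  also have "(pderiv_dir 1 f has_integral (f R - f (- R))) {- R..R}"
    using R f by (intro fundamental_theorem_of_calculus smooth_has_vector_derivative)
      (auto simp: test_functions_def)
  then have "integral {- R..R} (pderiv_dir 1 f) = f R - f (- R)"
    by (rule integral_unique)
  also have "\<dots> = 0"
    using R by simp
  finally show ?thesis .
qed

lemma pderiv_dir_mult_character:
  fixes f :: "'a::euclidean_space \<Rightarrow> complex"
  assumes "smooth f"
  shows "pderiv_dir b (\<lambda>x. f x * character k x) =
    (\<lambda>x. pderiv_dir b f x * character k x + - (\<i> * of_real (k \<bullet> b)) * (f x * character k x))"
  by (subst pderiv_dir_eqI[OF has_derivative_mult[OF smooth_has_derivative[OF assms]
        has_derivative_character]]) (simp add: fun_eq_iff algebra_simps)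

definition fourier_fun :: "(real \<Rightarrow> complex) \<Rightarrow> real \<Rightarrow> complex" where
  "fourier_fun f k = (LINT x|lborel. f x * character k x)"

lemma fourier_dist_times_one:
  assumes "\<rho> \<in> test_functions UNIV"
  shows "fourier (dist_times (dist_of_fun UNIV (\<lambda>x. 1)) \<rho>) k = fourier_fun \<rho> k"
  using assms test_functions_mult[OF assms smooth_character[of k]]
  by (simp add: fourier_def dist_times_def dist_of_fun_def fourier_fun_def)

text \<open>Integration by parts: the derivative of \<open>f\<close> times the character has
  integral zero, and the product rule splits it into the two sides.\<close>

lemma fourier_fun_derivative:
  assumes f: "f \<in> test_functions UNIV"
  shows "fourier_fun (pderiv_dir 1 f) k = \<i> * of_real k * fourier_fun f k"
proof -
  note g = test_functions_mult[OF f smooth_character[of k]]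
  note g' = test_functions_mult[OF test_functions_pderiv_dir[OF f, of 1] smooth_character[of k]]
  have "0 = (LINT x|lborel. pderiv_dir 1 f x * character k x
      + - (\<i> * of_real (k \<bullet> 1)) * (f x * character k x))"
    using integral_derivative_test_function[OF g]
    by (simp only: pderiv_dir_mult_character[OF test_function_smooth[OF f]])
  also have "\<dots> = fourier_fun (pderiv_dir 1 f) k + - (\<i> * of_real (k \<bullet> 1)) * fourier_fun f k"
    unfolding fourier_fun_def using g g'
    by (subst Bochner_Integration.integral_add)
      (auto intro!: test_function_integrable integrable_mult_right simp del: mult_minus_left)
  finally show ?thesis
    by (simp add: algebra_simps)
qed

text \<open>One more factor 1 + |k| costs one derivative: |k| times the transform of
  \<open>f\<close> is, in modulus, the transform of its derivative, so the constants for
  \<open>f\<close> and its derivative add up. The induction therefore ranges over all test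
  functions.\<close>

lemma fourier_fun_decay:
  assumes "f \<in> test_functions UNIV"
  shows "\<exists>C. \<forall>k. (1 + \<bar>k\<bar>) ^ N * cmod (fourier_fun f k) \<le> C"
  using assms
proof (induction N arbitrary: f)
  case 0
  have "cmod (fourier_fun f k) \<le> (LINT x|lborel. cmod (f x * character k x))" for k
    unfolding fourier_fun_def by (rule integral_norm_bound)
  then have "cmod (fourier_fun f k) \<le> (LINT x|lborel. cmod (f x))" for k
    by (simp only: norm_mult cmod_character mult_1_right)
  then show ?case by auto
next
  case (Suc N)
  obtain C where C: "\<And>k. (1 + \<bar>k\<bar>) ^ N * cmod (fourier_fun f k) \<le> C"
    using Suc by blast
  obtain C' where C': "\<And>k. (1 + \<bar>k\<bar>) ^ N * cmod (fourier_fun (pderiv_dir 1 f) k) \<le> C'"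
    using Suc.IH[OF test_functions_pderiv_dir[OF Suc.prems]] by auto
  have "(1 + \<bar>k\<bar>) ^ Suc N * cmod (fourier_fun f k) \<le> C + C'" for k
    using C[of k] C'[of k]
    by (simp add: fourier_fun_derivative[OF Suc.prems] norm_mult algebra_simps)
  then show ?case by blast
qed

section \<open>Growth of modulated test functions\<close>

lemma partial_derivs_lincomb:
  assumes "smooth f" "smooth g" "set bs \<subseteq> Basis"
  shows "partial_derivs bs (\<lambda>x. a * f x + b * g x) =
    (\<lambda>x. a * partial_derivs bs f x + b * partial_derivs bs g x)"
  using assms(3)
proof (induction bs)
  case (Cons c bs)
  have "((\<lambda>x. a * partial_derivs bs f x + b * partial_derivs bs g x) has_derivative
      (\<lambda>h. a * frechet_derivative (partial_derivs bs f) (at x) h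
         + b * frechet_derivative (partial_derivs bs g) (at x) h)) (at x)" for x
    using Cons.prems assms
    by (intro has_derivative_add has_derivative_mult_right smooth_has_derivative smooth_partial_derivs)
      auto
  from pderiv_dir_eqI[OF this, of c] Cons show ?case by simp
qed auto

text \<open>The induction peels off the last list entry, which is the derivative applied first. The
  product rule then gives two functions of the same shape, one with \<open>f\<close> differentiated
  and one with a factor k \<bullet> b, so each derivative costs at most one power of 1 +
  |k|.\<close>

lemma partial_derivs_mult_character_bound:
  fixes f :: "'a::euclidean_space \<Rightarrow> complex"
  assumes "f \<in> test_functions UNIV" "set bs \<subseteq> Basis"
  shows "\<exists>C\<ge>0. \<forall>k x. cmod (partial_derivs bs (\<lambda>x. f x * character k x) x)
    \<le> C * (1 + norm k) ^ length bs"
  using assms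
proof (induction bs arbitrary: f rule: rev_induct)
  case Nil
  have "\<forall>k x. cmod (f x * character k x) \<le> Ck_norm 0 f"
    using cmod_le_Ck_norm[OF Nil(1)] by (simp only: norm_mult cmod_character) simp
  moreover have "0 \<le> Ck_norm 0 f"
    using cmod_le_Ck_norm[OF Nil(1)] norm_ge_zero order_trans by blast
  ultimately show ?case by auto
next
  case (snoc b bs)
  let ?g = "\<lambda>k x. f x * character k x" and ?g' = "\<lambda>k x. pderiv_dir b f x * character k x"
  have b: "b \<in> Basis" "set bs \<subseteq> Basis" using snoc.prems by auto
  note f' = test_functions_pderiv_dir[OF snoc.prems(1) b(1)]
  obtain C where C: "C \<ge> 0" "\<And>k x. cmod (partial_derivs bs (?g k) x) \<le> C * (1 + norm k) ^ length bs"
    using snoc b by blast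
  obtain C' where C': "C' \<ge> 0"
    "\<And>k x. cmod (partial_derivs bs (?g' k) x) \<le> C' * (1 + norm k) ^ length bs"
    using snoc.IH[OF f' b(2)] by blast
  have "cmod (partial_derivs (bs @ [b]) (?g k) x) \<le> (C + C') * (1 + norm k) ^ length (bs @ [b])" for k x
  proof -
    have "partial_derivs (bs @ [b]) (?g k) = partial_derivs bs (pderiv_dir b (?g k))"
      by (simp add: partial_derivs_append)
    also have "\<dots> = partial_derivs bs (\<lambda>x. 1 * ?g' k x + - (\<i> * of_real (k \<bullet> b)) * ?g k x)"
      by (simp only: pderiv_dir_mult_character[OF test_function_smooth[OF snoc.prems(1)]] mult_1_left)
    also have "\<dots> = (\<lambda>x. 1 * partial_derivs bs (?g' k) x
        + - (\<i> * of_real (k \<bullet> b)) * partial_derivs bs (?g k) x)"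
      by (intro partial_derivs_lincomb smooth_mult smooth_character b
          test_function_smooth[OF snoc.prems(1)] test_function_smooth[OF f'])
    finally have "cmod (partial_derivs (bs @ [b]) (?g k) x)
        \<le> cmod (partial_derivs bs (?g' k) x) + \<bar>k \<bullet> b\<bar> * cmod (partial_derivs bs (?g k) x)"
      by (simp add: norm_mult order_trans[OF norm_triangle_ineq4])
    also have "\<dots> \<le> C' * (1 + norm k) ^ length bs + norm k * (C * (1 + norm k) ^ length bs)"
      using C C' Basis_le_norm[OF b(1), of k]
      by (intro add_mono mult_mono) auto
    also have "\<dots> \<le> (C + C') * (1 + norm k) ^ length (bs @ [b])"
      using C(1) C'(1) by (simp add: algebra_simps)
    finally show ?thesis .
  qed
  then show ?case
    using C(1) C'(1) by (intro exI[of _ "C + C'"]) auto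
qed

lemma Ck_norm_mult_character_bound:
  fixes f :: "'a::euclidean_space \<Rightarrow> complex"
  assumes f: "f \<in> test_functions UNIV"
  obtains C where "C \<ge> 0" "\<And>k. Ck_norm m (\<lambda>x. f x * character k x) \<le> C * (1 + norm k) ^ m"
proof -
  let ?A = "{bs. set bs \<subseteq> (Basis :: 'a set) \<and> length bs \<le> m}"
  have "\<forall>bs\<in>?A. \<exists>C\<ge>0. \<forall>k x. cmod (partial_derivs bs (\<lambda>x. f x * character k x) x)
      \<le> C * (1 + norm k) ^ length bs"
    using partial_derivs_mult_character_bound[OF f] by blast
  from bchoice[OF this] obtain C where "\<forall>bs\<in>?A. C bs \<ge> 0 \<and>
      (\<forall>k x. cmod (partial_derivs bs (\<lambda>x. f x * character k x) x) \<le> C bs * (1 + norm k) ^ length bs)"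
    ..
  then have C: "C bs \<ge> 0"
      "cmod (partial_derivs bs (\<lambda>x. f x * character k x) x) \<le> C bs * (1 + norm k) ^ length bs"
    if "bs \<in> ?A" for bs k x
    using that by blast+
  show ?thesis
  proof
    show "0 \<le> sum C ?A"
      using C by (intro sum_nonneg) auto
    fix k
    have "(SUP x. cmod (partial_derivs bs (\<lambda>x. f x * character k x) x)) \<le> C bs * (1 + norm k) ^ m"
      if "bs \<in> ?A" for bs
    proof (rule cSUP_least)
      fix x
      have "(1 + norm k) ^ length bs \<le> (1 + norm k) ^ m"
        using that by (intro power_increasing) auto
      then show "cmod (partial_derivs bs (\<lambda>x. f x * character k x) x) \<le> C bs * (1 + norm k) ^ m"
        using C(2)[OF that, of k x] C(1)[OF that] by (meson mult_left_mono order_trans)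
    qed auto
    then show "Ck_norm m (\<lambda>x. f x * character k x) \<le> sum C ?A * (1 + norm k) ^ m"
      unfolding Ck_norm_def sum_distrib_right by (intro sum_mono) auto
  qed
qed

section \<open>Integration over the fibres\<close>

text \<open>The pairing of the slice of \<open>\<phi>\<close> at \<open>x\<close> with the constant
  distribution 1. Thus u \<boxtimes> 1 is u composed with this map, and its properties reduce to
  linearity and continuity of \<open>fibre_integral\<close>.\<close>

definition fibre_integral :: "(real \<times> real \<Rightarrow> complex) \<Rightarrow> real \<Rightarrow> complex" where
  "fibre_integral \<phi> = (\<lambda>x. LINT y|lborel. \<phi> (x, y))"

lemma compact_subset_square:
  fixes K :: "(real \<times> real) set"
  assumes "compact K"
  obtains R where "R > 0" "K \<subseteq> {- R..R} \<times> {- R..R}"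
proof -
  obtain B where B: "\<And>z. z \<in> K \<Longrightarrow> norm z \<le> B" "B > 0"
    using compact_imp_bounded[OF assms] bounded_pos by metis
  have "z \<in> {- B..B} \<times> {- B..B}" if "z \<in> K" for z
    using B(1)[OF that] norm_fst_le[of "fst z" "snd z"] norm_snd_le[of "snd z" "fst z"]
    by (auto simp: mem_Times_iff abs_le_iff)
  then show ?thesis
    using that[of B] B(2) by blast
qed

lemma fibre_integral_eq_integral:
  assumes \<phi>: "\<phi> \<in> test_functions UNIV" and R: "fun_supp \<phi> \<subseteq> {- R..R} \<times> {- R..R}"
  shows "fibre_integral \<phi> x = integral {- R..R} (\<lambda>y. \<phi> (x, y))"
  unfolding fibre_integral_def
proof (rule lborel_integral_eq_integral_compact)
  show "continuous_on {- R..R} (\<lambda>y. \<phi> (x, y))"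
    by (intro smooth_continuous_on test_function_smooth[OF test_functions_slice[OF \<phi>]])
  show "\<phi> (x, y) = 0" if "y \<notin> {- R..R}" for y
    using that R by (intro fun_supp_eq_0) auto
qed auto

lemma fst_Basis: "(1::real, 0::real) \<in> Basis"
  by (simp add: Basis_prod_def)

text \<open>All slices are supported in one interval [-R, R], which turns the integral over the line
  into one over a fixed compact interval and permits differentiation under it.\<close>

lemma fibre_integral_has_vector_derivative:
  assumes \<phi>: "\<phi> \<in> test_functions UNIV"
  shows "(fibre_integral \<phi> has_vector_derivative fibre_integral (pderiv_dir (1, 0) \<phi>) x) (at x)"
proof -
  let ?\<phi>' = "pderiv_dir (1, 0) \<phi>"
  obtain R where R: "R > 0" "fun_supp \<phi> \<subseteq> {- R..R} \<times> {- R..R}"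
    using compact_subset_square[OF test_function_compact[OF \<phi>]] by blast
  note \<phi>' = test_functions_pderiv_dir[OF \<phi> fst_Basis]
  have supp: "fun_supp ?\<phi>' \<subseteq> {- R..R} \<times> {- R..R}"
    using R(2) partial_derivs_outside_fun_supp[of _ \<phi> "[(1, 0)]"]
    by (intro fun_supp_subset closed_Times) auto
  have "((\<lambda>x. integral (cbox (- R) R) (\<lambda>y. \<phi> (x, y))) has_vector_derivative
      integral (cbox (- R) R) (\<lambda>y. ?\<phi>' (x, y))) (at x within UNIV)"
  proof (rule leibniz_rule_vector_derivative)
    fix x t :: real
    let ?D = "frechet_derivative \<phi> (at (x, t))"
    have D: "(\<phi> has_derivative ?D) (at (x, t))"
      by (rule smooth_has_derivative[OF test_function_smooth[OF \<phi>]])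
    have "?D (h, 0) = h *\<^sub>R ?D (1, 0)" for h
      using linear_cmul[OF has_derivative_linear[OF D], of h "(1, 0)"] by simp
    then have "(\<lambda>h. ?D (h, 0)) = (\<lambda>h. h *\<^sub>R ?D (1, 0))" ..
    moreover have "((\<lambda>x. (x, t)) has_derivative (\<lambda>h. (h, 0))) (at x)"
      by (intro has_derivative_Pair has_derivative_ident has_derivative_const)
    from has_derivative_compose[OF this D]
    have "((\<lambda>x. \<phi> (x, t)) has_derivative (\<lambda>h. ?D (h, 0))) (at x)" .
    ultimately show "((\<lambda>x. \<phi> (x, t)) has_vector_derivative ?\<phi>' (x, t)) (at x within UNIV)"
      unfolding has_vector_derivative_def by (simp only:)
  next
    show "(\<lambda>y. \<phi> (x, y)) integrable_on cbox (- R) R" for x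
      by (intro integrable_continuous smooth_continuous_on
          test_function_smooth[OF test_functions_slice[OF \<phi>]])
    show "continuous_on (UNIV \<times> cbox (- R) R) (\<lambda>(x, t). ?\<phi>' (x, t))"
      using smooth_continuous_on[OF test_function_smooth[OF \<phi>']] by (simp add: case_prod_beta)
  qed auto
  moreover have "fibre_integral \<phi> = (\<lambda>x. integral (cbox (- R) R) (\<lambda>y. \<phi> (x, y)))"
    "fibre_integral ?\<phi>' x = integral (cbox (- R) R) (\<lambda>y. ?\<phi>' (x, y))"
    using fibre_integral_eq_integral[OF \<phi> R(2)] fibre_integral_eq_integral[OF \<phi>' supp]
    by (simp_all add: fun_eq_iff cbox_interval)
  ultimately show ?thesis by simp
qed

lemma pderiv_dir_fibre_integral:
  assumes "\<phi> \<in> test_functions UNIV"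
  shows "pderiv_dir 1 (fibre_integral \<phi>) = fibre_integral (pderiv_dir (1, 0) \<phi>)"
  using pderiv_dir_eqI[OF fibre_integral_has_vector_derivative[OF assms, unfolded has_vector_derivative_def]]
  by simp

lemma fibre_integral_outside:
  assumes "fun_supp \<phi> \<subseteq> A \<times> B" "x \<notin> A"
  shows "fibre_integral \<phi> x = 0"
proof -
  have "\<phi> (x, y) = 0" for y
    using assms by (intro fun_supp_eq_0) auto
  then show ?thesis by (simp add: fibre_integral_def)
qed

text \<open>The set of all fibre integrals of test functions is stable under differentiation, since
  the derivative is the fibre integral of another test function. It is the invariant set for
  \<open>smooth_coinduct\<close>.\<close>

lemma test_functions_fibre_integral:
  assumes \<phi>: "\<phi> \<in> test_functions UNIV"
  shows "fibre_integral \<phi> \<in> test_functions UNIV"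
proof -
  obtain R where R: "fun_supp \<phi> \<subseteq> {- R..R} \<times> {- R..R}"
    using compact_subset_square[OF test_function_compact[OF \<phi>]] by blast
  have "smooth (fibre_integral \<phi>)"
  proof (rule smooth_coinduct[of _ "fibre_integral ` test_functions UNIV"])
    fix g assume "g \<in> fibre_integral ` test_functions UNIV"
    then obtain \<psi> where \<psi>: "\<psi> \<in> test_functions UNIV" and g: "g = fibre_integral \<psi>" by auto
    show "g differentiable_on UNIV"
      unfolding g by (rule differentiable_onI_has_derivative
          [OF fibre_integral_has_vector_derivative[OF \<psi>, unfolded has_vector_derivative_def]])
    fix b :: real assume "b \<in> Basis"
    then show "pderiv_dir b g \<in> fibre_integral ` test_functions UNIV"
      using \<psi> test_functions_pderiv_dir[OF \<psi> fst_Basis]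
      by (simp add: g pderiv_dir_fibre_integral)
  qed (use \<phi> in simp)
  then show ?thesis
    by (rule test_functionsI[of _ "{- R..R}"]) (auto intro: fibre_integral_outside[OF R])
qed

lemma partial_derivs_fibre_integral:
  assumes \<phi>: "\<phi> \<in> test_functions UNIV" and bs: "set bs \<subseteq> Basis"
  shows "partial_derivs bs (fibre_integral \<phi>) =
    fibre_integral (partial_derivs (map (\<lambda>b. (b, 0)) bs) \<phi>)"
  using bs
proof (induction bs)
  case (Cons b bs)
  have "set (map (\<lambda>b::real. (b, 0::real)) bs) \<subseteq> Basis"
    using Cons.prems by (auto simp: Basis_prod_def)
  from pderiv_dir_fibre_integral[OF test_functions_partial_derivs[OF \<phi> this]]
  show ?case using Cons by simp
qed simp

text \<open>Derivatives of the fibre integral are fibre integrals of derivatives in the first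
  variable, over an interval of length 2R.\<close>

lemma Ck_norm_fibre_integral_le:
  assumes \<phi>: "\<phi> \<in> test_functions UNIV" and R: "fun_supp \<phi> \<subseteq> {- R..R} \<times> {- R..R}" "R > 0"
  shows "Ck_norm m (fibre_integral \<phi>) \<le> 2 * R * Ck_norm m \<phi>"
proof -
  let ?e = "map (\<lambda>b::real. (b, 0::real))"
  let ?A = "{bs. set bs \<subseteq> (Basis :: real set) \<and> length bs \<le> m}"
  let ?B = "{bs. set bs \<subseteq> (Basis :: (real \<times> real) set) \<and> length bs \<le> m}"
  let ?S = "\<lambda>bs. SUP z. cmod (partial_derivs bs \<phi> z)"
  have e: "?e ` ?A \<subseteq> ?B"
    by (auto simp: Basis_prod_def)
  have "(SUP x. cmod (partial_derivs bs (fibre_integral \<phi>) x)) \<le> 2 * R * ?S (?e bs)"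
    if bs: "bs \<in> ?A" for bs
  proof (rule cSUP_least)
    fix x
    have e_bs: "set (?e bs) \<subseteq> Basis" using bs e by blast
    note \<psi> = test_functions_partial_derivs[OF \<phi> e_bs]
    have "cmod (fibre_integral (partial_derivs (?e bs) \<phi>) x) \<le> ?S (?e bs) * measure lborel {- R..R}"
      unfolding fibre_integral_def
    proof (rule cmod_lborel_integral_le[OF test_functions_slice[OF \<psi>]])
      show "fun_supp (\<lambda>y. partial_derivs (?e bs) \<phi> (x, y)) \<subseteq> {- R..R}"
        using R(1) by (intro fun_supp_subset partial_derivs_outside_fun_supp) auto
    qed (auto intro: cmod_partial_derivs_le_SUP[OF \<phi> e_bs])
    then show "cmod (partial_derivs bs (fibre_integral \<phi>) x) \<le> 2 * R * ?S (?e bs)"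
      using bs R(2) by (simp add: partial_derivs_fibre_integral[OF \<phi>] mult.commute)
  qed auto
  then have "Ck_norm m (fibre_integral \<phi>) \<le> (\<Sum>bs\<in>?A. 2 * R * ?S (?e bs))"
    unfolding Ck_norm_def by (rule sum_mono)
  also have "\<dots> = 2 * R * (\<Sum>bs\<in>?e ` ?A. ?S bs)"
  proof -
    \<comment> \<open>Distinct lists lift to distinct lists, so the right-hand side is a partial sum
      of \<open>Ck_norm m \<phi>\<close>, whose terms are nonnegative.\<close>
    have "inj_on ?e ?A"
      by (rule inj_on_subset[OF inj_mapI]) (auto simp: inj_def)
    then show ?thesis
      by (simp add: sum.reindex sum_distrib_left)
  qed
  also have "\<dots> \<le> 2 * R * Ck_norm m \<phi>"
    unfolding Ck_norm_def using e R(2) SUP_cmod_partial_derivs_nonneg[OF \<phi>]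
    by (intro mult_left_mono sum_mono2 finite_lists_Basis) auto
  finally show ?thesis .
qed

section \<open>The exterior product with the constant function\<close>

lemma distributions_cmult:
  assumes "u \<in> distributions \<Omega>" "\<phi> \<in> test_functions \<Omega>"
  shows "u (\<lambda>x. c * \<phi> x) = c * u \<phi>"
proof -
  have "u (\<lambda>x. c * \<phi> x + 0 * \<phi> x) = c * u \<phi> + 0 * u \<phi>"
    using assms unfolding distributions_def by blast
  then show ?thesis by simp
qed

lemma ext_tensor_one:
  fixes \<phi> :: "real \<times> real \<Rightarrow> complex"
  assumes "\<phi> \<in> test_functions UNIV"
  shows "ext_tensor UNIV UNIV u (dist_of_fun UNIV (\<lambda>x. 1)) \<phi> = u (fibre_integral \<phi>)"
  using assms test_functions_slice[OF assms]
  by (simp add: ext_tensor_def dist_of_fun_def fibre_integral_def)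

lemma fibre_integral_lincomb:
  assumes "\<phi> \<in> test_functions UNIV" "\<psi> \<in> test_functions UNIV"
  shows "fibre_integral (\<lambda>z. a * \<phi> z + b * \<psi> z) =
    (\<lambda>x. a * fibre_integral \<phi> x + b * fibre_integral \<psi> x)"
proof
  fix x
  show "fibre_integral (\<lambda>z. a * \<phi> z + b * \<psi> z) x = a * fibre_integral \<phi> x + b * fibre_integral \<psi> x"
    unfolding fibre_integral_def
    by (subst Bochner_Integration.integral_add)
      (intro test_function_integrable test_functions_cmult test_functions_slice assms | simp)+
qed

lemma ext_tensor_one_distribution:
  assumes u: "u \<in> distributions (UNIV :: real set)"
  shows "ext_tensor UNIV UNIV u (dist_of_fun UNIV (\<lambda>x. 1)) \<in> distributions (UNIV :: (real \<times> real) set)"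
proof -
  let ?T = "ext_tensor UNIV UNIV u (dist_of_fun (UNIV :: real set) (\<lambda>x. 1))"
  have "?T (\<lambda>x. a * \<phi> x + b * \<psi> x) = a * ?T \<phi> + b * ?T \<psi>"
    if \<phi>: "\<phi> \<in> test_functions UNIV" and \<psi>: "\<psi> \<in> test_functions UNIV" for \<phi> \<psi> a b
  proof -
    have "u (\<lambda>x. a * fibre_integral \<phi> x + b * fibre_integral \<psi> x)
        = a * u (fibre_integral \<phi>) + b * u (fibre_integral \<psi>)"
      using u test_functions_fibre_integral[OF \<phi>] test_functions_fibre_integral[OF \<psi>]
      unfolding distributions_def by blast
    then show ?thesis
      using that by (simp add: ext_tensor_one test_functions_add test_functions_cmult fibre_integral_lincomb)
  qed
  moreover have "\<exists>C m. \<forall>\<phi>\<in>test_functions UNIV. fun_supp \<phi> \<subseteq> K \<longrightarrow> cmod (?T \<phi>) \<le> C * Ck_norm m \<phi>"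
    if K: "compact K" for K
  proof -
    obtain R where R: "R > 0" "K \<subseteq> {- R..R} \<times> {- R..R}"
      using compact_subset_square[OF K] by blast
    obtain C m where C: "C \<ge> 0" "\<And>\<phi>. \<phi> \<in> test_functions UNIV \<Longrightarrow> fun_supp \<phi> \<subseteq> {- R..R} \<Longrightarrow>
        cmod (u \<phi>) \<le> C * Ck_norm m \<phi>"
      using distributions_estimate[OF u, of "{- R..R}"] by auto
    have "cmod (?T \<phi>) \<le> C * (2 * R) * Ck_norm m \<phi>"
      if \<phi>: "\<phi> \<in> test_functions UNIV" and supp: "fun_supp \<phi> \<subseteq> K" for \<phi>
    proof -
      have S: "fun_supp \<phi> \<subseteq> {- R..R} \<times> {- R..R}" using supp R(2) by blast
      have "cmod (?T \<phi>) \<le> C * Ck_norm m (fibre_integral \<phi>)"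
        using fibre_integral_outside[OF S]
        by (simp only: ext_tensor_one[OF \<phi>])
          (intro C(2) test_functions_fibre_integral \<phi> fun_supp_subset closed_atLeastAtMost)
      also have "\<dots> \<le> C * (2 * R * Ck_norm m \<phi>)"
        by (intro mult_left_mono Ck_norm_fibre_integral_le \<phi> S R C)
      finally show ?thesis by (simp add: mult.assoc)
    qed
    then show ?thesis by blast
  qed
  ultimately show ?thesis
    by (intro distributionsI) (simp add: ext_tensor_def)
qed

text \<open>The character of the plane factors, so the fibre integral is a scalar multiple of a
  modulated \<open>\<rho>\<^sub>1\<close>. This product formula drives both the wave front estimate
  and the failure of continuity.\<close>

lemma fourier_ext_tensor_one:
  assumes u: "u \<in> distributions (UNIV :: real set)"
    and \<rho>: "\<rho>\<^sub>1 \<in> test_functions UNIV" "\<rho>\<^sub>2 \<in> test_functions UNIV"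
  shows "fourier (dist_times (ext_tensor UNIV UNIV u (dist_of_fun UNIV (\<lambda>x. 1)))
      (\<lambda>z. \<rho>\<^sub>1 (fst z) * \<rho>\<^sub>2 (snd z))) (k\<^sub>1, k\<^sub>2)
    = u (\<lambda>x. \<rho>\<^sub>1 x * character k\<^sub>1 x) * fourier_fun \<rho>\<^sub>2 k\<^sub>2"
proof -
  let ?\<phi> = "\<lambda>z :: real \<times> real. \<rho>\<^sub>1 (fst z) * \<rho>\<^sub>2 (snd z) * character (k\<^sub>1, k\<^sub>2) z"
  have \<phi>: "?\<phi> \<in> test_functions UNIV"
    by (intro test_functions_mult test_functions_tensor \<rho> smooth_character)
  have "?\<phi> (x, y) = \<rho>\<^sub>1 x * character k\<^sub>1 x * (\<rho>\<^sub>2 y * character k\<^sub>2 y)" for x y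
  proof -
    have "character (k\<^sub>1, k\<^sub>2) (x, y) = character k\<^sub>1 x * character k\<^sub>2 y"
      by (simp add: algebra_simps flip: exp_add)
    then show ?thesis by (simp only: fst_conv snd_conv mult_ac)
  qed
  then have "fibre_integral ?\<phi> = (\<lambda>x. fourier_fun \<rho>\<^sub>2 k\<^sub>2 * (\<rho>\<^sub>1 x * character k\<^sub>1 x))"
    by (simp only: fibre_integral_def fourier_fun_def integral_mult_right_zero mult.commute)
  then have "ext_tensor UNIV UNIV u (dist_of_fun UNIV (\<lambda>x. 1)) ?\<phi>
      = fourier_fun \<rho>\<^sub>2 k\<^sub>2 * u (\<lambda>x. \<rho>\<^sub>1 x * character k\<^sub>1 x)"
    using ext_tensor_one[OF \<phi>] distributions_cmult[OF u test_functions_mult[OF \<rho>(1) smooth_character]]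
    by simp
  then show ?thesis
    by (simp add: fourier_def dist_times_def mult.commute)
qed

text \<open>The easy half of Paley-Wiener-Schwartz: modulation does not enlarge the support, so one
  estimate with fixed \<open>C\<close> and \<open>m\<close> holds for every frequency, and the norm
  of the modulated function grows like |k|^m.\<close>

lemma distribution_character_bound:
  assumes u: "u \<in> distributions (UNIV :: 'a::euclidean_space set)" and \<rho>: "\<rho> \<in> test_functions UNIV"
  obtains C m where "C \<ge> 0" "\<And>k. cmod (u (\<lambda>x. \<rho> x * character k x)) \<le> C * (1 + norm k) ^ m"
proof -
  obtain C m where C: "C \<ge> 0" "\<And>\<phi>. \<phi> \<in> test_functions UNIV \<Longrightarrow> fun_supp \<phi> \<subseteq> fun_supp \<rho> \<Longrightarrow>
      cmod (u \<phi>) \<le> C * Ck_norm m \<phi>"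
    using distributions_estimate[OF u test_function_compact[OF \<rho>]] by blast
  obtain C' where C': "C' \<ge> 0" "\<And>k. Ck_norm m (\<lambda>x. \<rho> x * character k x) \<le> C' * (1 + norm k) ^ m"
    using Ck_norm_mult_character_bound[OF \<rho>] by blast
  show ?thesis
  proof
    show "C * C' \<ge> 0" using C C' by simp
    fix k
    have "fun_supp (\<lambda>x. \<rho> x * character k x) \<subseteq> fun_supp \<rho>"
      by (intro fun_supp_subset) (auto simp: fun_supp_eq_0, simp add: fun_supp_def)
    then have "cmod (u (\<lambda>x. \<rho> x * character k x)) \<le> C * Ck_norm m (\<lambda>x. \<rho> x * character k x)"
      by (intro C test_functions_mult \<rho> smooth_character)
    also have "\<dots> \<le> C * (C' * (1 + norm k) ^ m)"
      by (intro mult_left_mono C C')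
    finally show "cmod (u (\<lambda>x. \<rho> x * character k x)) \<le> C * C' * (1 + norm k) ^ m"
      by (simp add: mult.assoc)
  qed
qed

section \<open>Wave front sets of 1 and of u \<boxtimes> 1\<close>

lemma exists_test_function_nonzero_on_interval:
  "\<exists>\<rho>\<in>test_functions UNIV. \<forall>x::real. \<bar>x - a\<bar> < 1 \<longrightarrow> \<rho> x \<noteq> 0"
proof (rule exists_bump[of a])
  fix r :: "real \<Rightarrow> real"
  assume pos: "\<And>y. r y > 0 \<longleftrightarrow> \<bar>y - a\<bar> < 1"
    and r: "(\<lambda>x. complex_of_real (r x)) \<in> test_functions UNIV"
  have "complex_of_real (r x) \<noteq> 0" if "\<bar>x - a\<bar> < 1" for x using pos[of x] that by simp
  with r show ?thesis
    by (intro bexI[of _ "\<lambda>x. complex_of_real (r x)"]) auto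
qed

lemma exists_test_function_nonzero:
  obtains \<rho> where "\<rho> \<in> test_functions UNIV" "\<rho> (x::real) \<noteq> 0"
  using exists_test_function_nonzero_on_interval[of x] by fastforce

lemma not_in_wave_front_setI:
  assumes "\<rho> \<in> test_functions \<Omega>" "\<rho> x \<noteq> 0" "cone V" "\<xi> \<in> interior V"
    and "\<And>N. \<exists>C. \<forall>k\<in>V. (1 + norm k) ^ N * cmod (fourier (dist_times u \<rho>) k) \<le> C"
  shows "(x, \<xi>) \<notin> wave_front_set \<Omega> u"
  using assms unfolding wave_front_set_def by blast

lemma wave_front_set_one: "wave_front_set UNIV (dist_of_fun (UNIV :: real set) (\<lambda>x. 1)) = {}"
proof -
  have "(x, \<xi>) \<notin> wave_front_set UNIV (dist_of_fun (UNIV :: real set) (\<lambda>x. 1))" for x \<xi>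
  proof -
    obtain \<rho> where \<rho>: "\<rho> \<in> test_functions UNIV" "\<rho> x \<noteq> 0"
      using exists_test_function_nonzero by blast
    then show ?thesis
      using fourier_fun_decay[OF \<rho>(1)]
      by (intro not_in_wave_front_setI[OF \<rho>, of UNIV]) (auto simp: fourier_dist_times_one cone_def)
  qed
  then show ?thesis by auto
qed

lemma wave_front_set_ext_tensor_one:
  assumes u: "u \<in> distributions (UNIV :: real set)"
    and mem: "((x, y), (\<xi>, \<eta>)) \<in> wave_front_set UNIV (ext_tensor UNIV UNIV u (dist_of_fun UNIV (\<lambda>x. 1)))"
  shows "\<eta> = (0::real)"
proof (rule ccontr)
  assume \<eta>: "\<eta> \<noteq> 0"
  let ?T = "ext_tensor UNIV UNIV u (dist_of_fun (UNIV :: real set) (\<lambda>x. 1))"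
  obtain \<rho>\<^sub>1 where \<rho>\<^sub>1: "\<rho>\<^sub>1 \<in> test_functions UNIV" "\<rho>\<^sub>1 x \<noteq> 0"
    using exists_test_function_nonzero by blast
  obtain \<rho>\<^sub>2 where \<rho>\<^sub>2: "\<rho>\<^sub>2 \<in> test_functions UNIV" "\<rho>\<^sub>2 y \<noteq> 0"
    using exists_test_function_nonzero by blast
  let ?\<rho> = "\<lambda>z. \<rho>\<^sub>1 (fst z) * \<rho>\<^sub>2 (snd z)"
  \<comment> \<open>The summand 1 makes M |\<eta>| strictly larger than |\<xi>|, which places the
    covector in the interior of \<open>V\<close>.\<close>
  define M where "M = \<bar>\<xi>\<bar> / \<bar>\<eta>\<bar> + 1"
  define V where "V = {k::real \<times> real. \<bar>fst k\<bar> \<le> M * \<bar>snd k\<bar>}"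
  have M: "M \<ge> 0" by (simp add: M_def)
  have "cone V"
    unfolding cone_def V_def
    by (auto simp: abs_mult mult.left_commute[of M] mult_left_mono)
  moreover have "(\<xi>, \<eta>) \<in> interior V"
  proof (rule interiorI)
    show "open {k::real \<times> real. \<bar>fst k\<bar> < M * \<bar>snd k\<bar>}"
      by (intro open_Collect_less continuous_intros)
    show "(\<xi>, \<eta>) \<in> {k. \<bar>fst k\<bar> < M * \<bar>snd k\<bar>}"
      using \<eta> by (simp add: M_def distrib_right)
  qed (auto simp: V_def)
  moreover have "\<exists>C. \<forall>k\<in>V. (1 + norm k) ^ N * cmod (fourier (dist_times ?T ?\<rho>) k) \<le> C" for N
  proof -
    obtain C m where C: "C \<ge> 0" "\<And>k. cmod (u (\<lambda>x. \<rho>\<^sub>1 x * character k x)) \<le> C * (1 + norm k) ^ m"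
      using distribution_character_bound[OF u \<rho>\<^sub>1(1)] by blast
    \<comment> \<open>The extra exponent \<open>m\<close> absorbs the growth of the factor coming
      from \<open>u\<close>: on \<open>V\<close> both 1 + |k| and 1 + |k_1| are at most (1 + M)(1 +
      |k_2|).\<close>
    obtain D where D: "\<And>k. (1 + \<bar>k\<bar>) ^ (N + m) * cmod (fourier_fun \<rho>\<^sub>2 k) \<le> D"
      using fourier_fun_decay[OF \<rho>\<^sub>2(1)] by blast
    have "(1 + norm k) ^ N * cmod (fourier (dist_times ?T ?\<rho>) k) \<le> C * (1 + M) ^ (N + m) * D"
      if "k \<in> V" for k
    proof -
      obtain k\<^sub>1 k\<^sub>2 where k: "k = (k\<^sub>1, k\<^sub>2)" by (cases k)
      have k\<^sub>1: "\<bar>k\<^sub>1\<bar> \<le> M * \<bar>k\<^sub>2\<bar>" using that by (simp add: V_def k)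
      then have le: "1 + \<bar>k\<^sub>1\<bar> + \<bar>k\<^sub>2\<bar> \<le> (1 + M) * (1 + \<bar>k\<^sub>2\<bar>)"
        using M by (simp add: algebra_simps)
      have "norm k \<le> \<bar>k\<^sub>1\<bar> + \<bar>k\<^sub>2\<bar>"
        using norm_Pair_le[of k\<^sub>1 k\<^sub>2] by (simp add: k)
      then have "(1 + norm k) ^ N \<le> ((1 + M) * (1 + \<bar>k\<^sub>2\<bar>)) ^ N"
        using le by (intro power_mono) auto
      moreover have "cmod (u (\<lambda>x. \<rho>\<^sub>1 x * character k\<^sub>1 x)) \<le> C * ((1 + M) * (1 + \<bar>k\<^sub>2\<bar>)) ^ m"
      proof -
        have "(1 + \<bar>k\<^sub>1\<bar>) ^ m \<le> ((1 + M) * (1 + \<bar>k\<^sub>2\<bar>)) ^ m"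
          using le by (intro power_mono) auto
        then show ?thesis
          using C(2)[of k\<^sub>1] C(1) by (auto intro: order_trans mult_left_mono)
      qed
      ultimately have "(1 + norm k) ^ N * (cmod (u (\<lambda>x. \<rho>\<^sub>1 x * character k\<^sub>1 x)) * cmod (fourier_fun \<rho>\<^sub>2 k\<^sub>2))
          \<le> ((1 + M) * (1 + \<bar>k\<^sub>2\<bar>)) ^ N * (C * ((1 + M) * (1 + \<bar>k\<^sub>2\<bar>)) ^ m * cmod (fourier_fun \<rho>\<^sub>2 k\<^sub>2))"
        using M C(1) by (intro mult_mono) auto
      also have "\<dots> = C * (1 + M) ^ (N + m) * ((1 + \<bar>k\<^sub>2\<bar>) ^ (N + m) * cmod (fourier_fun \<rho>\<^sub>2 k\<^sub>2))"
        by (simp add: power_mult_distrib power_add)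
      also have "\<dots> \<le> C * (1 + M) ^ (N + m) * D"
        using C(1) M by (intro mult_left_mono D) auto
      finally show ?thesis
        by (simp add: k fourier_ext_tensor_one[OF u \<rho>\<^sub>1(1) \<rho>\<^sub>2(1)] norm_mult)
    qed
    then show ?thesis by blast
  qed
  ultimately have "((x, y), (\<xi>, \<eta>)) \<notin> wave_front_set UNIV ?T"
    using \<rho>\<^sub>1 \<rho>\<^sub>2 test_functions_tensor[OF \<rho>\<^sub>1(1) \<rho>\<^sub>2(1)]
    by (intro not_in_wave_front_setI[of ?\<rho> _ _ V]) auto
  with mem show False by contradiction
qed

section \<open>Linear algebra\<close>

text \<open>Gaussian elimination: a nonzero coefficient in row \<open>i\<^sub>0\<close> is the
  pivot; removing its row and column lowers the number of equations and of unknowns by one.\<close>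

lemma underdetermined_system:
  fixes a :: "'i \<Rightarrow> 'j \<Rightarrow> 'k::field"
  assumes "finite I" "finite J" "card I < card J"
  shows "\<exists>c. (\<exists>j\<in>J. c j \<noteq> 0) \<and> (\<forall>i\<in>I. (\<Sum>j\<in>J. c j * a i j) = 0)"
  using assms
proof (induction I arbitrary: J a rule: finite_induct)
  case empty
  then have "J \<noteq> {}" by auto
  then show ?case by (intro exI[of _ "\<lambda>_. 1"]) auto
next
  case (insert i\<^sub>0 I)
  show ?case
  proof (cases "\<forall>j\<in>J. a i\<^sub>0 j = 0")
    case True
    from insert have "card I < card J" by simp
    then obtain c where "\<exists>j\<in>J. c j \<noteq> 0" "\<forall>i\<in>I. (\<Sum>j\<in>J. c j * a i j) = 0"
      using insert.IH[OF insert.prems(1), of a] by blast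
    then show ?thesis
      using True by (intro exI[of _ c]) auto
  next
    case False
    then obtain j\<^sub>0 where j\<^sub>0: "j\<^sub>0 \<in> J" "a i\<^sub>0 j\<^sub>0 \<noteq> 0" by blast
    let ?J = "J - {j\<^sub>0}"
    define b where "b i j = a i j - a i j\<^sub>0 / a i\<^sub>0 j\<^sub>0 * a i\<^sub>0 j" for i j
    have "finite ?J" "card I < card ?J"
      using insert j\<^sub>0 by (simp_all add: card_Diff_singleton)
    then obtain c where c: "\<exists>j\<in>?J. c j \<noteq> 0" "\<forall>i\<in>I. (\<Sum>j\<in>?J. c j * b i j) = 0"
      using insert.IH[of ?J b] by blast
    define s where "s = (\<Sum>j\<in>?J. c j * a i\<^sub>0 j)"
    \<comment> \<open>The eliminated unknown is chosen to satisfy the pivot equation; by the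
      definition of \<open>b\<close> the other equations then hold as well.\<close>
    define c' where "c' = c(j\<^sub>0 := - s / a i\<^sub>0 j\<^sub>0)"
    have sum: "(\<Sum>j\<in>J. c' j * a i j) = (\<Sum>j\<in>?J. c j * a i j) - s / a i\<^sub>0 j\<^sub>0 * a i j\<^sub>0" for i
      using insert.prems(1) j\<^sub>0(1) by (simp add: sum.remove c'_def)
    have "(\<Sum>j\<in>J. c' j * a i j) = 0" if "i \<in> I" for i
    proof -
      have "(\<Sum>j\<in>?J. c j * b i j) = (\<Sum>j\<in>?J. c j * a i j) - a i j\<^sub>0 / a i\<^sub>0 j\<^sub>0 * s"
        by (simp add: b_def s_def algebra_simps sum_subtractf sum_distrib_left)
      then show ?thesis
        using c(2) that by (simp add: sum mult.commute)
    qed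
    moreover have "(\<Sum>j\<in>J. c' j * a i\<^sub>0 j) = 0"
      using j\<^sub>0(2) by (simp add: sum flip: s_def)
    moreover have "\<exists>j\<in>J. c' j \<noteq> 0"
      using c(1) by (auto simp: c'_def)
    ultimately show ?thesis by blast
  qed
qed

text \<open>Weighting \<open>d j\<close> by \<open>z j - z m\<close> kills the term of
  \<open>m\<close> at the price of one power: moment \<open>l\<close> of the new weights uses
  moments \<open>l\<close> and \<open>Suc l\<close> of the old ones. The induction gives zero new
  weights, and distinct nodes allow division.\<close>

lemma vandermonde_injective:
  fixes z :: "'j \<Rightarrow> 'k::field"
  assumes "finite J" "inj_on z J" "\<And>l. l < card J \<Longrightarrow> (\<Sum>j\<in>J. d j * z j ^ l) = 0" "j \<in> J"
  shows "d j = 0"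
  using assms
proof (induction J arbitrary: d j rule: finite_induct)
  case (insert m J)
  have "d i * (z i - z m) = 0" if "i \<in> J" for i
  proof (rule insert.IH[OF _ _ that, of "\<lambda>j. d j * (z j - z m)"])
    show "inj_on z J" using insert.prems(1) by (simp add: inj_on_insert)
    fix l assume l: "l < card J"
    have "(\<Sum>j\<in>J. d j * (z j - z m) * z j ^ l) = (\<Sum>j\<in>insert m J. d j * (z j - z m) * z j ^ l)"
      using insert.hyps by simp
    also have "\<dots> = (\<Sum>j\<in>insert m J. d j * z j ^ Suc l) - z m * (\<Sum>j\<in>insert m J. d j * z j ^ l)"
      unfolding sum_distrib_left sum_subtractf[symmetric]
      by (intro sum.cong) (auto simp: algebra_simps)
    also have "\<dots> = 0"
      using insert.prems(2)[of l] insert.prems(2)[of "Suc l"] l insert.hyps by simp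
    finally show "(\<Sum>j\<in>J. d j * (z j - z m) * z j ^ l) = 0" .
  qed
  moreover have "z i \<noteq> z m" if "i \<in> J" for i
    using insert.prems(1) insert.hyps that by (auto simp: inj_on_def)
  ultimately have J: "d i = 0" if "i \<in> J" for i
    using that by auto
  moreover have "d m = 0"
    using insert.prems(2)[of 0] insert.hyps J by simp
  ultimately show ?case using insert.prems(3) by auto
qed simp

section \<open>The failure of continuity\<close>

text \<open>Each seminorm here depends only on the value at one test function, so a subbasic ball
  needs a single element of \<open>F\<close>. Intersections merge the finite sets, and a union keeps
  the set of one member containing \<open>u\<^sub>0\<close>.\<close>

lemma hormander_topology_full_nbhd:
  fixes u\<^sub>0 :: "('a::euclidean_space \<Rightarrow> complex) \<Rightarrow> complex"
  assumes "openin (hormander_topology UNIV (punctured_cotangent UNIV)) U" "u\<^sub>0 \<in> U"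
  shows "\<exists>F. finite F \<and> F \<subseteq> test_functions UNIV \<and>
    (\<forall>u\<in>distributions_wf UNIV (punctured_cotangent UNIV). (\<forall>\<phi>\<in>F. u \<phi> = u\<^sub>0 \<phi>) \<longrightarrow> u \<in> U)"
proof -
  let ?D = "distributions_wf UNIV (punctured_cotangent (UNIV :: 'a set))"
  let ?B = "{{v \<in> ?D. p (\<lambda>\<phi>. v \<phi> - w \<phi>) < ennreal \<epsilon>} | p w \<epsilon>.
      p \<in> hormander_seminorms UNIV (punctured_cotangent (UNIV :: 'a set)) \<and> w \<in> ?D \<and> \<epsilon> > 0}"
  have "generate_topology_on ?B U"
    using assms(1) by (simp add: hormander_topology_def openin_topology_generated_by_iff)
  then show ?thesis
    using assms(2)
  proof (induction rule: generate_topology_on.induct)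
    case Empty
    then show ?case by simp
  next
    case (Int A B)
    then obtain F G where "finite F" "F \<subseteq> test_functions UNIV"
        "\<forall>u\<in>?D. (\<forall>\<phi>\<in>F. u \<phi> = u\<^sub>0 \<phi>) \<longrightarrow> u \<in> A"
      and "finite G" "G \<subseteq> test_functions UNIV"
        "\<forall>u\<in>?D. (\<forall>\<phi>\<in>G. u \<phi> = u\<^sub>0 \<phi>) \<longrightarrow> u \<in> B"
      by auto
    then show ?case
      by (intro exI[of _ "F \<union> G"]) auto
  next
    case (UN K)
    then obtain A where "A \<in> K" "u\<^sub>0 \<in> A" by blast
    with UN.IH[of A] show ?case by blast
  next
    case (Basis A)
    then obtain p w \<epsilon> where A: "A = {v \<in> ?D. p (\<lambda>\<phi>. v \<phi> - w \<phi>) < ennreal \<epsilon>}"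
      and p: "p \<in> hormander_seminorms UNIV (punctured_cotangent (UNIV :: 'a set))"
      by auto
    have "\<exists>\<psi>\<in>test_functions UNIV. \<forall>v v'. v \<psi> = v' \<psi> \<longrightarrow> p v = p v'"
    proof -
      consider \<phi> where "\<phi> \<in> test_functions UNIV" "p = weak_seminorm \<phi>"
        | N V \<rho> where "\<rho> \<in> test_functions UNIV" "p = decay_seminorm N V \<rho>"
          "(fun_supp \<rho> \<times> V) \<inter> punctured_cotangent UNIV = {}"
        using p unfolding hormander_seminorms_def by blast
      then show ?thesis
      proof cases
        case 1
        then show ?thesis by (intro bexI[of _ \<phi>]) (simp_all add: weak_seminorm_def)
      next
        case 2
        \<comment> \<open>either \<open>\<rho> = 0\<close> or \<open>V\<close> is contained in the origin\<close>
        have "(\<lambda>x. \<rho> x * character k x) = \<rho>" if "k \<in> V" for k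
        proof
          fix x
          show "\<rho> x * character k x = \<rho> x"
            using 2(3) that fun_supp_eq_0[of x \<rho>]
            by (cases "k = 0") (auto simp: punctured_cotangent_def)
        qed
        then have "fourier (dist_times v \<rho>) k = v \<rho>" if "k \<in> V" for v k
          using that by (simp add: fourier_def dist_times_def)
        then have "p v = p v'" if "v \<rho> = v' \<rho>" for v v'
          using that by (simp add: 2(2) decay_seminorm_def cong: SUP_cong)
        with 2(1) show ?thesis by blast
      qed
    qed
    then obtain \<psi> where \<psi>: "\<psi> \<in> test_functions UNIV" "\<And>v v'. v \<psi> = v' \<psi> \<Longrightarrow> p v = p v'"
      by blast
    have "u \<in> A" if "u \<in> ?D" "u \<psi> = u\<^sub>0 \<psi>" for u
      \<comment> \<open>The centre \<open>w\<close> need not be \<open>u\<^sub>0\<close>: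
        subtracting the same \<open>w\<close> preserves agreement at \<open>\<psi>\<close>.\<close>
      using \<psi>(2)[of "\<lambda>\<phi>. u \<phi> - w \<phi>" "\<lambda>\<phi>. u\<^sub>0 \<phi> - w \<phi>"] that Basis.prems by (simp add: A)
    with \<psi>(1) show ?case
      by (intro exI[of _ "{\<psi>}"]) auto
  qed
qed

section \<open>Combinations of point masses\<close>

definition point_masses :: "'j set \<Rightarrow> ('j \<Rightarrow> complex) \<Rightarrow> ('j \<Rightarrow> 'a::euclidean_space) \<Rightarrow> ('a \<Rightarrow> complex) \<Rightarrow> complex" where
  "point_masses J c x = (\<lambda>\<phi>. if \<phi> \<in> test_functions UNIV then \<Sum>j\<in>J. c j * \<phi> (x j) else 0)"

lemma point_masses_distribution: "point_masses J c x \<in> distributions UNIV"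
proof (rule distributionsI)
  show "point_masses J c x \<phi> = 0" if "\<phi> \<notin> test_functions UNIV" for \<phi>
    using that by (simp add: point_masses_def)
  show "point_masses J c x (\<lambda>y. a * \<phi> y + b * \<psi> y) = a * point_masses J c x \<phi> + b * point_masses J c x \<psi>"
    if "\<phi> \<in> test_functions UNIV" "\<psi> \<in> test_functions UNIV" for \<phi> \<psi> a b
    using that
    by (simp add: point_masses_def test_functions_add test_functions_cmult sum_distrib_left
        algebra_simps flip: sum.distrib)
  have "cmod (point_masses J c x \<phi>) \<le> (\<Sum>j\<in>J. cmod (c j)) * Ck_norm 0 \<phi>"
    if "\<phi> \<in> test_functions UNIV" for \<phi>
  proof -
    have "cmod (point_masses J c x \<phi>) \<le> (\<Sum>j\<in>J. cmod (c j * \<phi> (x j)))"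
      using that by (simp add: point_masses_def norm_sum)
    also have "\<dots> \<le> (\<Sum>j\<in>J. cmod (c j) * Ck_norm 0 \<phi>)"
      unfolding norm_mult by (intro sum_mono mult_left_mono cmod_le_Ck_norm that) auto
    finally show ?thesis by (simp add: sum_distrib_right)
  qed
  then show "\<exists>C m. \<forall>\<phi>\<in>test_functions UNIV. fun_supp \<phi> \<subseteq> K \<longrightarrow>
      cmod (point_masses J c x \<phi>) \<le> C * Ck_norm m \<phi>" for K
    by blast
qed

text \<open>With n = card F, the n conditions from \<open>F\<close> leave a nonzero coefficient
  vector on n + 1 points. Multiplying it by the values of \<open>\<rho>\<close>, nonzero at these
  points, keeps it nonzero, so one of its first n + 1 power moments is nonzero.\<close>

lemma exists_distribution_detecting_character:
  assumes F: "finite F" "F \<subseteq> test_functions UNIV"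
    and \<rho>: "\<rho> \<in> test_functions UNIV" "\<And>x::real. \<bar>x\<bar> < 1 \<Longrightarrow> \<rho> x \<noteq> 0"
  shows "\<exists>u\<in>distributions UNIV. (\<forall>\<phi>\<in>F. u \<phi> = 0) \<and>
    (\<exists>k. \<bar>k\<bar> \<le> 1 \<and> u (\<lambda>x. \<rho> x * character k x) = 1)"
proof -
  define n where "n = card F"
  \<comment> \<open>The same grid in [0, 1) supplies the positions, where \<open>\<rho>\<close> does
    not vanish, and the frequencies, which must not exceed 1 in modulus.\<close>
  define t where "t j = real j / real (Suc n)" for j
  let ?J = "{..n}"
  define z where "z j = character (1 / real (Suc n)) (t j)" for j
  have t: "0 \<le> t j" "t j < 1" if "j \<in> ?J" for j
    using that by (auto simp: t_def)
  obtain c where c: "\<exists>j\<in>?J. c j \<noteq> 0" "\<forall>\<phi>\<in>F. (\<Sum>j\<in>?J. c j * \<phi> (t j)) = 0"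
    using underdetermined_system[of F ?J "\<lambda>\<phi> j. \<phi> (t j)"] F(1) by (auto simp: n_def)
  have power: "z j ^ l = character (t l) (t j)" for j l
    by (simp add: z_def t_def field_simps flip: exp_of_nat_mult)
  have "inj_on z ?J"
  proof (rule inj_onI)
    fix i j assume ij: "i \<in> ?J" "j \<in> ?J" "z i = z j"
    define \<theta> where "\<theta> j = t j / real (Suc n)" for j
    have \<theta>: "0 \<le> \<theta> j \<and> \<theta> j < 1" if "j \<in> ?J" for j
      using t[OF that] by (simp add: \<theta>_def field_simps)
    \<comment> \<open>The nodes are exp(-i \<theta>) with all angles in [0, 1), too short an arc for
      two of them to coincide.\<close>
    have bound: "\<bar>\<theta> j - \<theta> i\<bar> < 2 * pi"
      using \<theta>[OF ij(1)] \<theta>[OF ij(2)] pi_gt3 by linarith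
    have "- \<i> * of_real (\<theta> i) = - \<i> * of_real (\<theta> j)"
    proof (rule exp_complex_eqI)
      show "\<bar>Im (- \<i> * of_real (\<theta> i)) - Im (- \<i> * of_real (\<theta> j))\<bar> < 2 * pi"
        using bound by simp
      show "exp (- \<i> * of_real (\<theta> i)) = exp (- \<i> * of_real (\<theta> j))"
        using ij(3) by (simp add: z_def \<theta>_def)
    qed
    then show "i = j" by (simp add: t_def \<theta>_def del: of_nat_Suc)
  qed
  moreover obtain j where j: "j \<in> ?J" "c j * \<rho> (t j) \<noteq> 0"
    using c(1) \<rho>(2) t by fastforce
  ultimately have "\<exists>l<card ?J. (\<Sum>j\<in>?J. c j * \<rho> (t j) * z j ^ l) \<noteq> 0"
    using vandermonde_injective[of ?J z "\<lambda>j. c j * \<rho> (t j)" j] by blast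
  then obtain l where l: "l \<le> n" "(\<Sum>j\<in>?J. c j * \<rho> (t j) * z j ^ l) \<noteq> 0"
    by (auto simp: less_Suc_eq_le)
  \<comment> \<open>The nonzero moment; dividing the coefficients by it normalizes the detected
    value to 1 and preserves vanishing on \<open>F\<close>.\<close>
  define s where "s = (\<Sum>j\<in>?J. c j * \<rho> (t j) * z j ^ l)"
  let ?u = "point_masses ?J (\<lambda>j. c j / s) t"
  have "?u \<phi> = 0" if "\<phi> \<in> F" for \<phi>
    using c(2) that by (simp add: point_masses_def flip: sum_divide_distrib)
  moreover have "?u (\<lambda>x. \<rho> x * character (t l) x) = s / s"
    using test_functions_mult[OF \<rho>(1) smooth_character[of "t l"]]
    unfolding s_def sum_divide_distrib power by (simp add: point_masses_def mult.assoc)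
  then have "?u (\<lambda>x. \<rho> x * character (t l) x) = 1"
    using l(2) by (simp add: s_def)
  moreover have "\<bar>t l\<bar> \<le> 1"
    using t[of l] l(1) by simp
  ultimately show ?thesis
    using point_masses_distribution by blast
qed

lemma zero_distribution: "(\<lambda>\<phi>. 0) \<in> distributions UNIV"
  by (rule distributionsI) (auto intro: exI[of _ 0])

text \<open>Modulating a bump by e^{ix} moves frequency 0 to frequency 1, so the transform at 1 is
  the integral of a nonnegative function that is positive on an interval.\<close>

lemma exists_fourier_fun_nonzero:
  obtains \<rho> where "\<rho> \<in> test_functions UNIV" "fourier_fun \<rho> 1 \<noteq> 0"
proof (rule exists_bump[of 0])
  fix r :: "real \<Rightarrow> real"
  assume nonneg: "\<And>x. r x \<ge> 0" and pos: "\<And>x. r x > 0 \<longleftrightarrow> \<bar>x - 0\<bar> < 1"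
    and r: "(\<lambda>x. complex_of_real (r x)) \<in> test_functions UNIV"
  let ?\<rho> = "\<lambda>x. complex_of_real (r x) * character (- 1) x"
  have "?\<rho> x * character 1 x = complex_of_real (r x)" for x
    by (simp flip: exp_add)
  then have "fourier_fun ?\<rho> 1 = complex_of_real (LINT x|lborel. r x)"
    by (simp only: fourier_fun_def integral_complex_of_real)
  moreover have "(LINT x|lborel. r x) \<noteq> 0"
  proof
    assume "(LINT x|lborel. r x) = 0"
    moreover have "integrable lborel r"
      using test_function_integrable[OF r] by (simp only: complex_of_real_integrable_eq)
    ultimately have "AE x in lborel. r x = 0"
      using nonneg by (subst (asm) integral_nonneg_eq_0_iff_AE) auto
    then have "AE x in lborel. x \<notin> {- 1<..<1::real}"
    proof (rule eventually_mono)
      show "x \<notin> {- 1<..<1}" if "r x = 0" for x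
        using pos[of x] that by (auto simp: abs_less_iff)
    qed
    then have "{- 1<..<1::real} \<in> null_sets lborel"
      by (subst AE_iff_null_sets) auto
    then show False by (simp add: null_sets_def)
  qed
  ultimately show ?thesis
    by (intro that[OF test_functions_mult[OF r smooth_character[of "- 1"]]]) simp
qed

text \<open>The conjuncts before the last one ensure that the failure is genuine:
  \<open>continuous_map\<close> would also fail if \<open>T\<close> merely left the target
  space.\<close>

theorem mainTheorem2:
  fixes \<Gamma>\<^sub>1 \<Gamma>\<^sub>2 :: "(real \<times> real) set"
    and \<Gamma> :: "((real \<times> real) \<times> (real \<times> real)) set"
    and one :: "(real \<Rightarrow> complex) \<Rightarrow> complex"
    and T :: "((real \<Rightarrow> complex) \<Rightarrow> complex) \<Rightarrow> (real \<times> real \<Rightarrow> complex) \<Rightarrow> complex"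
  assumes "\<Gamma>\<^sub>1 = punctured_cotangent UNIV"
    and "\<Gamma>\<^sub>2 = {}"
    and "\<Gamma> = {((x\<^sub>1, x\<^sub>2), (\<xi>\<^sub>1, 0)) | x\<^sub>1 x\<^sub>2 \<xi>\<^sub>1. \<xi>\<^sub>1 \<noteq> 0}"
    and "one = dist_of_fun UNIV (\<lambda>x. 1)"
    and "T = (\<lambda>u. ext_tensor UNIV UNIV u one)"
  shows "distributions_wf UNIV \<Gamma>\<^sub>1 = distributions UNIV
    \<and> one \<in> distributions_wf UNIV \<Gamma>\<^sub>2
    \<and> T \<in> distributions_wf UNIV \<Gamma>\<^sub>1 \<rightarrow> distributions_wf UNIV \<Gamma>
    \<and> (\<forall>u\<in>distributions_wf UNIV \<Gamma>\<^sub>1. \<forall>v\<in>distributions_wf UNIV \<Gamma>\<^sub>1. \<forall>a b.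
         T (\<lambda>\<phi>. a * u \<phi> + b * v \<phi>) = (\<lambda>\<phi>. a * T u \<phi> + b * T v \<phi>))
    \<and> \<not> continuous_map (hormander_topology UNIV \<Gamma>\<^sub>1) (hormander_topology UNIV \<Gamma>) T"
proof (intro conjI)
  show full: "distributions_wf UNIV \<Gamma>\<^sub>1 = distributions UNIV"
    unfolding distributions_wf_def assms(1) wave_front_set_def by blast
  show "one \<in> distributions_wf UNIV \<Gamma>\<^sub>2"
    unfolding distributions_wf_def assms(2,4)
    using dist_of_fun_one_distribution wave_front_set_one by simp
  show T: "T \<in> distributions_wf UNIV \<Gamma>\<^sub>1 \<rightarrow> distributions_wf UNIV \<Gamma>"
  proof
    fix u assume "u \<in> distributions_wf UNIV \<Gamma>\<^sub>1"
    then have u: "u \<in> distributions UNIV" by (simp add: full)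
    have "wave_front_set UNIV (T u) \<subseteq> \<Gamma>"
    proof
      fix p assume p: "p \<in> wave_front_set UNIV (T u)"
      obtain x y \<xi> \<eta> where p_eq: "p = ((x, y), (\<xi>, \<eta>))" by (metis surj_pair)
      have "\<eta> = 0"
        using wave_front_set_ext_tensor_one[OF u] p by (simp add: p_eq assms(4,5))
      moreover have "(\<xi>, \<eta>) \<noteq> 0"
        using p unfolding wave_front_set_def punctured_cotangent_def p_eq by blast
      ultimately show "p \<in> \<Gamma>"
        by (auto simp: p_eq assms(3) zero_prod_def)
    qed
    then show "T u \<in> distributions_wf UNIV \<Gamma>"
      using ext_tensor_one_distribution[OF u] by (simp add: distributions_wf_def assms(4,5))
  qed
  show "\<forall>u\<in>distributions_wf UNIV \<Gamma>\<^sub>1. \<forall>v\<in>distributions_wf UNIV \<Gamma>\<^sub>1. \<forall>a b.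
      T (\<lambda>\<phi>. a * u \<phi> + b * v \<phi>) = (\<lambda>\<phi>. a * T u \<phi> + b * T v \<phi>)"
    by (auto simp: assms(5) ext_tensor_def)
  show "\<not> continuous_map (hormander_topology UNIV \<Gamma>\<^sub>1) (hormander_topology UNIV \<Gamma>) T"
  proof
    assume cont: "continuous_map (hormander_topology UNIV \<Gamma>\<^sub>1) (hormander_topology UNIV \<Gamma>) T"
    obtain \<rho>\<^sub>1 where \<rho>\<^sub>1: "\<rho>\<^sub>1 \<in> test_functions UNIV" "\<And>x::real. \<bar>x\<bar> < 1 \<Longrightarrow> \<rho>\<^sub>1 x \<noteq> 0"
      using exists_test_function_nonzero_on_interval[of 0] by auto
    obtain \<rho>\<^sub>2 where \<rho>\<^sub>2: "\<rho>\<^sub>2 \<in> test_functions UNIV" "fourier_fun \<rho>\<^sub>2 1 \<noteq> 0"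
      by (rule exists_fourier_fun_nonzero)
    define \<tau> where "\<tau> = (\<lambda>z :: real \<times> real. \<rho>\<^sub>1 (fst z) * \<rho>\<^sub>2 (snd z))"
    \<comment> \<open>Covectors in \<open>\<Gamma>\<close> have second component 0, and in
      \<open>V\<close> this forces the first one to vanish too.\<close>
    define V where "V = {k :: real \<times> real. \<bar>fst k\<bar> \<le> \<bar>snd k\<bar>}"
    \<comment> \<open>The radius is the modulus that T u attains at frequency (k, 1) when u takes
      the value 1 on the modulated \<open>\<rho>\<^sub>1\<close>; the strict inequality of the ball
      then fails.\<close>
    define \<epsilon> where "\<epsilon> = cmod (fourier_fun \<rho>\<^sub>2 1)"
    \<comment> \<open>No decay weight is required: the unweighted supremum, N = 0, is already
      unbounded on every neighbourhood of 0.\<close>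
    let ?p = "decay_seminorm 0 V \<tau>"
    \<comment> \<open>Subtracting 0 keeps the literal form of a subbasic ball, here with the zero
      distribution as centre.\<close>
    let ?B = "{v \<in> distributions_wf UNIV \<Gamma>. ?p (\<lambda>\<phi>. v \<phi> - 0) < ennreal \<epsilon>}"
    let ?U = "{u \<in> topspace (hormander_topology UNIV \<Gamma>\<^sub>1). T u \<in> ?B}"
    have \<epsilon>: "\<epsilon> > 0" using \<rho>\<^sub>2(2) by (simp add: \<epsilon>_def)
    have zero: "(\<lambda>\<phi>. 0) \<in> distributions_wf UNIV \<Gamma>\<^sub>1"
      using zero_distribution by (simp add: full)
    have T0: "T (\<lambda>\<phi>. 0) = (\<lambda>\<phi>. 0)"
      by (auto simp: assms(5) ext_tensor_def)
    have zero': "(\<lambda>\<phi>. 0) \<in> distributions_wf UNIV \<Gamma>"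
      using T zero T0 by (metis PiE)
    have p: "?p \<in> hormander_seminorms UNIV \<Gamma>"
    proof -
      have "closed V"
        unfolding V_def by (intro closed_Collect_le continuous_intros)
      moreover have "cone V"
        by (auto simp: cone_def V_def abs_mult mult_left_mono)
      moreover have "(fun_supp \<tau> \<times> V) \<inter> \<Gamma> = {}"
        by (auto simp: V_def assms(3))
      moreover have "\<tau> \<in> test_functions UNIV"
        unfolding \<tau>_def by (rule test_functions_tensor[OF \<rho>\<^sub>1(1) \<rho>\<^sub>2(1)])
      ultimately show ?thesis
        unfolding hormander_seminorms_def by blast
    qed
    have "openin (hormander_topology UNIV \<Gamma>) ?B"
      unfolding hormander_topology_def openin_topology_generated_by_iff
      by (intro generate_topology_on.Basis CollectI exI[of _ ?p] exI[of _ "\<lambda>\<phi>. 0"] exI[of _ \<epsilon>]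
          conjI refl p zero' \<epsilon>)
    then have U: "openin (hormander_topology UNIV \<Gamma>\<^sub>1) ?U"
      by (rule openin_continuous_map_preimage[OF cont])
    have "?p (\<lambda>\<phi>. 0) \<le> 0"
      unfolding decay_seminorm_def by (rule SUP_least) (simp add: fourier_def dist_times_def)
    then have zero_U: "(\<lambda>\<phi>. 0) \<in> ?U"
      using zero zero' \<epsilon> by (simp add: topspace_hormander_topology T0)
    have "\<exists>F. finite F \<and> F \<subseteq> test_functions UNIV \<and>
        (\<forall>u\<in>distributions_wf UNIV \<Gamma>\<^sub>1. (\<forall>\<phi>\<in>F. u \<phi> = 0) \<longrightarrow> u \<in> ?U)"
      using hormander_topology_full_nbhd[OF U[unfolded assms(1)] zero_U[unfolded assms(1)]]
      unfolding assms(1) .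
    then obtain F where F: "finite F" "F \<subseteq> test_functions UNIV"
        "\<forall>u\<in>distributions_wf UNIV \<Gamma>\<^sub>1. (\<forall>\<phi>\<in>F. u \<phi> = 0) \<longrightarrow> u \<in> ?U"
      by (elim exE conjE)
    obtain u k where u: "u \<in> distributions UNIV" "\<forall>\<phi>\<in>F. u \<phi> = 0"
      and k: "\<bar>k\<bar> \<le> 1" "u (\<lambda>x. \<rho>\<^sub>1 x * character k x) = 1"
      using exists_distribution_detecting_character[OF F(1,2) \<rho>\<^sub>1] by blast
    have "fourier (dist_times (T u) \<tau>) (k, 1) = fourier_fun \<rho>\<^sub>2 1"
      unfolding assms(4,5) \<tau>_def fourier_ext_tensor_one[OF u(1) \<rho>\<^sub>1(1) \<rho>\<^sub>2(1)] by (simp only: k mult_1_left)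
    then have "ennreal \<epsilon> = ennreal ((1 + norm (k, 1 :: real)) ^ 0 * cmod (fourier (dist_times (T u) \<tau>) (k, 1)))"
      by (simp add: \<epsilon>_def)
    also have "\<dots> \<le> ?p (T u)"
      unfolding decay_seminorm_def by (rule SUP_upper) (use k(1) in \<open>simp add: V_def\<close>)
    finally have "ennreal \<epsilon> \<le> ?p (T u)" .
    moreover have "u \<in> ?U"
      using F(3) u unfolding full by blast
    then have "?p (T u) < ennreal \<epsilon>" by simp
    ultimately show False by (meson leD)
  qed
qed

end
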